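(* Let $\mathscr{C}=(S,V_1,V_2,\Pi_1,\Pi_2,\langle\ ,\ \rangle)$ be a Coxeter datum. Suppose that $\alpha_1,\alpha_2\in\Phi_1(\mathscr{C})$ (arbitrary roots, not necessarily simple). Then $$\langle\alpha_1,\phi(\alpha_2)\rangle\,\langle\alpha_2,\phi(\alpha_1)\rangle\ \ge\ (\phi_1(\alpha_1),\phi_1(\alpha_2))^2.$$
   Context: **Coxeter datum.** Let $S$ be an arbitrary set in which each unordered pair $\{s,t\}$ of elements is assigned an $m_{st}\in\mathbb{Z}\cup\{\infty\}$ with $m_{ss}=1$ for all $s\in S$ and $m_{st}\ge 2$ for all distinct $s,t\in S$. For a subset $A$ of a real vector space, $\mathrm{PLC}(A)=\{\sum_{a\in A}\lambda_a a\mid \lambda_a\ge 0 \text{ for all } a\in A, \text{ and } \lambda_{a'}>0\text{ for some }a'\in A\}$ (finite sums). A Coxeter datum with Coxeter parameters $m_{st}$ is a tuple $\mathscr{C}=(S,V_1,V_2,\Pi_1,\Pi_2,\langle\ ,\ \rangle)$ where $V_1,V_2$ are real vector spaces, $\langle\ ,\ \rangle\colon V_1\times V_2\to\mathbb{R}$ is bilinear, $\Pi_1=\{\alpha_s\mid s\in S\}\subseteq V_1$ and $\Pi_2=\{\beta_s\mid s\in S\}\subseteq V_2$, such that: (C1) $\langle\alpha_s,\beta_s\rangle=1$ for all $s\in S$; (C2) $\langle\alpha_s,\beta_t\rangle\le 0$ for all distinct $s,t\in S$; (C3) for all $s,t\in S$, $\langle\alpha_s,\beta_t\rangle\langle\alpha_t,\beta_s\rangle=\cos^2(\pi/m_{st})$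 if $m_{st}\ne\infty$, and equals $\gamma^2$ for some $\gamma\ge1$ (depending on $s,t$) if $m_{st}=\infty$; (C4) $\langle\alpha_s,\beta_t\rangle=0$ if and only if $\langle\alpha_t,\beta_s\rangle=0$, for all $s,t\in S$; (C5) $0\notin\mathrm{PLC}(\Pi_1)$ and $0\notin\mathrm{PLC}(\Pi_2)$, in the sense that $\sum_{s\in S}\lambda_s\alpha_s=0$ with all $\lambda_s\ge0$ implies all $\lambda_s=0$, and likewise for the $\beta_s$. Linear independence of $\Pi_1,\Pi_2$ is not assumed. **Action and roots.** $(W,R)$, $R=\{r_s\mid s\in S\}$, is the abstract Coxeter system with parameters $m_{st}$ (relations $r_s^2=1$, $(r_sr_t)^{m_{st}}=1$ for $m_{st}\neq\infty$). $W$ acts on $V_1,V_2$ by $r_sx=x-2\langle x,\beta_s\rangle\alpha_s$ and $r_sy=y-2\langle\alpha_s,y\rangle\beta_s$. Put $\Phi_1(\mathscr{C})=W\Pi_1$, $\Phi_2(\mathscr{C})=W\Pi_2$. The map $\phi\colon\Phi_1(\mathscr{C})\to\Phi_2(\mathscr{C})$ is the (unique, well-defined) $W$-equivariant bijection with $\phi(\alpha_s)=\beta_s$ for all $s\in S$. **Standard geometric realization.** Let $V$ be a real vector space with basis $\{\gamma_s\mid s\in S\}$ and symmetric bilinear form $(\,,\,)$ with $(\gamma_s,\gamma_s)=1$ for all $s$, $(\gamma_s,\gamma_t)\le0$ for all $s\ne t$, and $(\gamma_s,\gamma_t)^2=\langle\alpha_s,\beta_t\rangle\langle\alpha_t,\beta_s\rangle$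 for all $s,t$. $W$ acts on $V$ by $r_sv=v-2(v,\gamma_s)\gamma_s$; $\Phi=\{w\gamma_s\mid w\in W,s\in S\}$. The map $\phi_1\colon\Phi_1(\mathscr{C})\to\Phi$ is the (well-defined) $W$-equivariant map with $\phi_1(\alpha_s)=\gamma_s$ for all $s\in S$. *)

theory Defs
  imports
    "HOL-Analysis.Linear_Algebra"
    "HOL-Algebra.Group_Action"
    "HOL-Library.Extended_Nat"
begin

section \<open>Abstract Coxeter groups\<close>

locale coxeter_parameters =
  fixes S :: "'s set" and m :: "'s \<Rightarrow> 's \<Rightarrow> enat"
  assumes m_sym: "\<lbrakk>s \<in> S; t \<in> S\<rbrakk> \<Longrightarrow> m s t = m t s"
    and m_diag: "s \<in> S \<Longrightarrow> m s s = 1"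
    and m_off_diag: "\<lbrakk>s \<in> S; t \<in> S; s \<noteq> t\<rbrakk> \<Longrightarrow> 2 \<le> m s t"

text \<open>
  The group is presented by words over \<open>S\<close> modulo the congruence generated by
  \<open>(r\<^sub>s r\<^sub>t)\<^bsup>m s t\<^esup> = 1\<close> for \<open>m s t \<noteq> \<infinity>\<close>. Formal inverses of the generators are not needed
  because \<open>m s s = 1\<close> makes each generator an involution.
\<close>

inductive coxeter_eq :: "'s set \<Rightarrow> ('s \<Rightarrow> 's \<Rightarrow> enat) \<Rightarrow> 's list \<Rightarrow> 's list \<Rightarrow> bool"
  for S m where
    coxeter_rel: "\<lbrakk>s \<in> S; t \<in> S; m s t = enat n; u \<in> lists S; v \<in> lists S\<rbrakk>
      \<Longrightarrow> coxeter_eq S m (u @ concat (replicate n [s, t]) @ v) (u @ v)"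
  | coxeter_refl: "w \<in> lists S \<Longrightarrow> coxeter_eq S m w w"
  | coxeter_sym: "coxeter_eq S m w w' \<Longrightarrow> coxeter_eq S m w' w"
  | coxeter_trans: "\<lbrakk>coxeter_eq S m w w'; coxeter_eq S m w' w''\<rbrakk> \<Longrightarrow> coxeter_eq S m w w''"

definition coxeter_class :: "'s set \<Rightarrow> ('s \<Rightarrow> 's \<Rightarrow> enat) \<Rightarrow> 's list \<Rightarrow> 's list set" where
  "coxeter_class S m w = {w'. coxeter_eq S m w w'}"

definition coxeter_group :: "'s set \<Rightarrow> ('s \<Rightarrow> 's \<Rightarrow> enat) \<Rightarrow> 's list set monoid" where
  "coxeter_group S m =
     \<lparr>carrier = coxeter_class S m ` lists S,
      mult = \<lambda>X Y. \<Union>x\<in>X. \<Union>y\<in>Y. coxeter_class S m (x @ y),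
      one = coxeter_class S m []\<rparr>"

definition coxeter_gen :: "'s set \<Rightarrow> ('s \<Rightarrow> 's \<Rightarrow> enat) \<Rightarrow> 's \<Rightarrow> 's list set" where
  "coxeter_gen S m s = coxeter_class S m [s]"

lemma coxeter_eq_lists:
  assumes "coxeter_eq S m w w'"
  shows "w \<in> lists S \<and> w' \<in> lists S"
  using assms
proof induction
  case (coxeter_rel s t n u v)
  have "concat (replicate n [s, t]) \<in> lists S"
    using coxeter_rel(1,2) by (induction n) auto
  with coxeter_rel show ?case by auto
qed auto

lemma coxeter_eq_context:
  assumes "coxeter_eq S m w w'" "p \<in> lists S" "q \<in> lists S"
  shows "coxeter_eq S m (p @ w @ q) (p @ w' @ q)"
  using assms
proof induction
  case (coxeter_rel s t n u v)
  then show ?case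
    using coxeter_eq.coxeter_rel[of s S t m n "p @ u" "v @ q"] by simp
next
  case (coxeter_refl w)
  then show ?case by (intro coxeter_eq.coxeter_refl) auto
next
  case (coxeter_sym w w')
  then show ?case by (intro coxeter_eq.coxeter_sym[of S m "p @ w @ q"]) simp
next
  case (coxeter_trans w w' w'')
  then show ?case
    by (intro coxeter_eq.coxeter_trans[of S m "p @ w @ q" "p @ w' @ q" "p @ w'' @ q"]) simp_all
qed

lemma coxeter_eq_append:
  assumes "coxeter_eq S m x x'" "coxeter_eq S m y y'"
  shows "coxeter_eq S m (x @ y) (x' @ y')"
proof (rule coxeter_trans)
  show "coxeter_eq S m (x @ y) (x' @ y)"
    using coxeter_eq_context[OF assms(1), of "[]" y] coxeter_eq_lists[OF assms(2)] by simp
  show "coxeter_eq S m (x' @ y) (x' @ y')"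
    using coxeter_eq_context[OF assms(2), of x' "[]"] coxeter_eq_lists[OF assms(1)] by simp
qed

lemma coxeter_class_eqI: "coxeter_eq S m w w' \<Longrightarrow> coxeter_class S m w = coxeter_class S m w'"
  unfolding coxeter_class_def
  by (intro Collect_cong iffI) (erule (1) coxeter_trans[OF coxeter_sym], erule (1) coxeter_trans)

lemma coxeter_mult_class:
  assumes "x \<in> lists S" "y \<in> lists S"
  shows "coxeter_class S m x \<otimes>\<^bsub>coxeter_group S m\<^esub> coxeter_class S m y = coxeter_class S m (x @ y)"
proof -
  have "coxeter_class S m (x' @ y') = coxeter_class S m (x @ y)"
    if "x' \<in> coxeter_class S m x" "y' \<in> coxeter_class S m y" for x' y'
    using that coxeter_class_eqI[OF coxeter_eq_append, of S m x x' y y']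
    by (simp add: coxeter_class_def)
  moreover have "x \<in> coxeter_class S m x" "y \<in> coxeter_class S m y"
    using assms by (auto simp: coxeter_class_def intro: coxeter_refl)
  ultimately have "(\<Union>x'\<in>coxeter_class S m x. \<Union>y'\<in>coxeter_class S m y. coxeter_class S m (x' @ y'))
      = coxeter_class S m (x @ y)"
    by blast
  then show ?thesis by (simp add: coxeter_group_def)
qed

lemma (in coxeter_parameters) group_coxeter_group: "group (coxeter_group S m)"
proof (rule groupI)
  have carr: "carrier (coxeter_group S m) = coxeter_class S m ` lists S"
    and one: "\<one>\<^bsub>coxeter_group S m\<^esub> = coxeter_class S m []"
    by (simp_all add: coxeter_group_def)
  show "\<one>\<^bsub>coxeter_group S m\<^esub> \<in> carrier (coxeter_group S m)"
    unfolding carr one by auto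
  show "x \<otimes>\<^bsub>coxeter_group S m\<^esub> y \<in> carrier (coxeter_group S m)"
    if "x \<in> carrier (coxeter_group S m)" "y \<in> carrier (coxeter_group S m)" for x y
  proof -
    from that obtain u v where "u \<in> lists S" "v \<in> lists S"
      "x = coxeter_class S m u" "y = coxeter_class S m v"
      unfolding carr by blast
    then show ?thesis
      using coxeter_mult_class[of u S v m] append_in_lists_conv[of u v S] unfolding carr by blast
  qed
  show "x \<otimes>\<^bsub>coxeter_group S m\<^esub> y \<otimes>\<^bsub>coxeter_group S m\<^esub> z
      = x \<otimes>\<^bsub>coxeter_group S m\<^esub> (y \<otimes>\<^bsub>coxeter_group S m\<^esub> z)"
    if "x \<in> carrier (coxeter_group S m)" "y \<in> carrier (coxeter_group S m)"
      "z \<in> carrier (coxeter_group S m)" for x y z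
  proof -
    from that obtain u v w where "u \<in> lists S" "v \<in> lists S" "w \<in> lists S"
      "x = coxeter_class S m u" "y = coxeter_class S m v" "z = coxeter_class S m w"
      unfolding carr by blast
    then show ?thesis
      using coxeter_mult_class[of u S v m] coxeter_mult_class[of v S w m]
        coxeter_mult_class[of "u @ v" S w m] coxeter_mult_class[of u S "v @ w" m]
        append_in_lists_conv[of u v S] append_in_lists_conv[of v w S]
      by (metis append_assoc)
  qed
  show "\<one>\<^bsub>coxeter_group S m\<^esub> \<otimes>\<^bsub>coxeter_group S m\<^esub> x = x"
    if "x \<in> carrier (coxeter_group S m)" for x
  proof -
    from that obtain w where "w \<in> lists S" "x = coxeter_class S m w"
      unfolding carr by blast
    then show ?thesis
      using coxeter_mult_class[of "[]" S w m] unfolding one by simp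
  qed
  have rev: "coxeter_eq S m (rev w @ w) []" if "w \<in> lists S" for w
    using that
  proof (induction w)
    case (Cons s w)
    have "coxeter_eq S m (rev w @ concat (replicate 1 [s, s]) @ w) (rev w @ w)"
      using Cons by (intro coxeter_rel) (auto simp: m_diag one_enat_def)
    then have "coxeter_eq S m (rev (s # w) @ (s # w)) (rev w @ w)" by simp
    moreover have "coxeter_eq S m (rev w @ w) []" using Cons by simp
    ultimately show ?case by (rule coxeter_trans)
  qed (auto intro: coxeter_refl)
  show "\<exists>y\<in>carrier (coxeter_group S m). y \<otimes>\<^bsub>coxeter_group S m\<^esub> x = \<one>\<^bsub>coxeter_group S m\<^esub>"
    if "x \<in> carrier (coxeter_group S m)" for x
  proof -
    from that obtain w where w: "w \<in> lists S" "x = coxeter_class S m w"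
      unfolding carr by blast
    have "rev w \<in> lists S" using w(1) by auto
    then have "coxeter_class S m (rev w) \<otimes>\<^bsub>coxeter_group S m\<^esub> x = \<one>\<^bsub>coxeter_group S m\<^esub>"
      unfolding one w(2) coxeter_mult_class[OF \<open>rev w \<in> lists S\<close> w(1)]
      by (intro coxeter_class_eqI rev w(1))
    moreover have "coxeter_class S m (rev w) \<in> carrier (coxeter_group S m)"
      using w unfolding carr by auto
    ultimately show ?thesis by blast
  qed
qed


section \<open>Coxeter data\<close>

definition PLC :: "'v::real_vector set \<Rightarrow> 'v set" where
  "PLC A = {\<Sum>a\<in>F. c a *\<^sub>R a | F c.
     finite F \<and> F \<subseteq> A \<and> (\<forall>a\<in>F. 0 \<le> c a) \<and> (\<exists>a\<in>F. 0 < c a)}"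

locale coxeter_datum = coxeter_parameters S m
  for S :: "'s set" and m :: "'s \<Rightarrow> 's \<Rightarrow> enat" +
  fixes pairing :: "'v1::real_vector \<Rightarrow> 'v2::real_vector \<Rightarrow> real"
    and \<alpha> :: "'s \<Rightarrow> 'v1"
    and \<beta> :: "'s \<Rightarrow> 'v2"
  assumes pairing_bilinear: "bilinear pairing"
    and C1: "s \<in> S \<Longrightarrow> pairing (\<alpha> s) (\<beta> s) = 1"
    and C2: "\<lbrakk>s \<in> S; t \<in> S; s \<noteq> t\<rbrakk> \<Longrightarrow> pairing (\<alpha> s) (\<beta> t) \<le> 0"
    and C3_finite: "\<lbrakk>s \<in> S; t \<in> S; m s t = enat n\<rbrakk>
      \<Longrightarrow> pairing (\<alpha> s) (\<beta> t) * pairing (\<alpha> t) (\<beta> s) = (cos (pi / real n))\<^sup>2"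
    and C3_infinite: "\<lbrakk>s \<in> S; t \<in> S; m s t = \<infinity>\<rbrakk>
      \<Longrightarrow> \<exists>d\<ge>1. pairing (\<alpha> s) (\<beta> t) * pairing (\<alpha> t) (\<beta> s) = d\<^sup>2"
    and C4: "\<lbrakk>s \<in> S; t \<in> S\<rbrakk> \<Longrightarrow> pairing (\<alpha> s) (\<beta> t) = 0 \<longleftrightarrow> pairing (\<alpha> t) (\<beta> s) = 0"
    and C5_1: "0 \<notin> PLC (\<alpha> ` S)"
    and C5_2: "0 \<notin> PLC (\<beta> ` S)"
begin

text \<open>
  The families \<open>\<alpha>\<close> and \<open>\<beta>\<close> are injective by C1 and C2, so the last two conditions agree with
  their versions for indexed families.
\<close>

lemma inj_on_\<alpha>: "inj_on \<alpha> S" and inj_on_\<beta>: "inj_on \<beta> S"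
proof -
  show "inj_on \<alpha> S"
    by (rule inj_onI) (metis C1 C2 not_one_le_zero)
  show "inj_on \<beta> S"
    by (rule inj_onI) (metis C1 C2 not_one_le_zero)
qed

lemma PLC_indexed:
  assumes "inj_on f S" "0 \<notin> PLC (f ` S)" "finite A" "A \<subseteq> S" "\<And>s. s \<in> A \<Longrightarrow> 0 \<le> c s"
    and "(\<Sum>s\<in>A. c s *\<^sub>R f s) = 0" and "s \<in> A"
  shows "c s = 0"
proof (rule ccontr)
  assume "c s \<noteq> 0"
  have inj: "inj_on f A" using assms(1,4) inj_on_subset by blast
  let ?d = "\<lambda>a. c (inv_into A f a)"
  have "(\<Sum>a\<in>f ` A. ?d a *\<^sub>R a) = 0"
    using assms(6) by (simp add: sum.reindex[OF inj] inv_into_f_f[OF inj])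
  moreover have "0 < ?d (f s)"
    using \<open>c s \<noteq> 0\<close> assms(5)[OF assms(7)] inv_into_f_f[OF inj assms(7)] by simp
  moreover have "\<forall>a\<in>f ` A. 0 \<le> ?d a"
    using assms(5) by (auto simp: inv_into_f_f[OF inj])
  ultimately have "0 \<in> PLC (f ` S)"
    unfolding PLC_def using assms(3,4,7)
    by (intro CollectI exI[of _ "f ` A"] exI[of _ ?d]) auto
  with assms(2) show False by contradiction
qed

lemmas C5_1_indexed = PLC_indexed[OF inj_on_\<alpha> C5_1]
  and C5_2_indexed = PLC_indexed[OF inj_on_\<beta> C5_2]

end

locale standard_realization = coxeter_datum S m pairing \<alpha> \<beta>
  for S :: "'s set" and m and pairing :: "'v1::real_vector \<Rightarrow> 'v2::real_vector \<Rightarrow> real"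
    and \<alpha> and \<beta> +
  fixes form :: "'v::real_vector \<Rightarrow> 'v \<Rightarrow> real"
    and \<gamma> :: "'s \<Rightarrow> 'v"
  assumes \<gamma>_inj: "inj_on \<gamma> S"
    and \<gamma>_independent: "independent (\<gamma> ` S)"
    and \<gamma>_span: "span (\<gamma> ` S) = UNIV"
    and form_bilinear: "bilinear form"
    and form_sym: "form x y = form y x"
    and form_diag: "s \<in> S \<Longrightarrow> form (\<gamma> s) (\<gamma> s) = 1"
    and form_off_diag: "\<lbrakk>s \<in> S; t \<in> S; s \<noteq> t\<rbrakk> \<Longrightarrow> form (\<gamma> s) (\<gamma> t) \<le> 0"
    and form_square: "\<lbrakk>s \<in> S; t \<in> S\<rbrakk>
      \<Longrightarrow> (form (\<gamma> s) (\<gamma> t))\<^sup>2 = pairing (\<alpha> s) (\<beta> t) * pairing (\<alpha> t) (\<beta> s)"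


section \<open>Reflection actions and roots\<close>

text \<open>
  \<open>act\<close> is the (unique) action of the Coxeter group in which the generator \<open>r\<^sub>s\<close> acts by
  \<open>x \<mapsto> x - 2 f\<^sub>s(x) e\<^sub>s\<close>.
\<close>

definition reflection_action ::
  "'s set \<Rightarrow> ('s \<Rightarrow> 's \<Rightarrow> enat) \<Rightarrow> ('s \<Rightarrow> 'v \<Rightarrow> real) \<Rightarrow> ('s \<Rightarrow> 'v)
    \<Rightarrow> ('s list set \<Rightarrow> 'v \<Rightarrow> 'v::real_vector) \<Rightarrow> bool" where
  "reflection_action S m f e act \<longleftrightarrow>
     group_action (coxeter_group S m) UNIV act \<and>
     (\<forall>s\<in>S. \<forall>x. act (coxeter_gen S m s) x = x - (2 * f s x) *\<^sub>R e s)"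

definition root_set ::
  "'s set \<Rightarrow> ('s \<Rightarrow> 's \<Rightarrow> enat) \<Rightarrow> ('s list set \<Rightarrow> 'v \<Rightarrow> 'v) \<Rightarrow> ('s \<Rightarrow> 'v) \<Rightarrow> 'v set" where
  "root_set S m act e = (\<Union>s\<in>S. orbit (coxeter_group S m) act (e s))"

definition equivariant_on ::
  "'s set \<Rightarrow> ('s \<Rightarrow> 's \<Rightarrow> enat) \<Rightarrow> ('s list set \<Rightarrow> 'v \<Rightarrow> 'v) \<Rightarrow> ('s list set \<Rightarrow> 'w \<Rightarrow> 'w)
    \<Rightarrow> 'v set \<Rightarrow> ('v \<Rightarrow> 'w) \<Rightarrow> bool" where
  "equivariant_on S m act act' X f \<longleftrightarrow>
     (\<forall>g\<in>carrier (coxeter_group S m). \<forall>x\<in>X. f (act g x) = act' g (f x))"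

end

theory Submission
  imports Defs
begin

text \<open>
  By invariance of the pairing under the group it suffices to treat a root and a simple root.
  Let \<open>X\<close> and \<open>Y\<close> be the two pairings on the left of the inequality and \<open>Z\<close> the pairing in the
  standard realization, so that the claim is \<open>Z\<^sup>2 \<le> X Y\<close>. Both \<open>V\<^sub>1\<close> and \<open>V\<^sub>2\<close> are replaced by
  the space \<open>V\<close>, with its basis \<open>\<gamma>\<close> and the pulled back, asymmetric form. Every root then has
  a unique coefficient \<open>\<lambda>\<close> at each basis vector, and so have its partners, say \<open>\<nu>\<close> and \<open>\<mu>\<close>.

  The first ingredient is that \<open>\<lambda>\<close>, \<open>\<nu>\<close> and \<open>\<mu>\<close> have the same sign and satisfy \<open>\<mu>\<^sup>2 \<le> \<lambda> \<nu>\<close>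
  (\<open>root_triple_coeff_dominates\<close>). It is proved like the positivity of roots, by reduction to
  rank two (\<open>ascent_induct\<close>). There the coefficients of the three root systems differ only by
  factors of which one is the geometric mean of the other two, and such triples are closed
  under sums by the Cauchy-Schwarz inequality.

  This does not bound the pairings directly, because they are combinations of the coefficients
  with mixed signs. Pairings do however appear as factors in the coefficients of other roots:
  the reflection of the simple root \<open>\<alpha>\<^sub>s\<close> in a root \<open>x\<close> is \<open>\<alpha>\<^sub>s - 2 Y x\<close>. This shows that \<open>X\<close>,
  \<open>Y\<close> and \<open>Z\<close> have the same sign (\<open>root_triple_pairing_sgn\<close>). When \<open>x\<close> is replaced by this new
  root, \<open>X Y\<close> and \<open>Z\<^sup>2\<close> both change by \<open>y \<mapsto> (1 - 2 y)\<^sup>2\<close>. Iterating, agreement of the signs at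
  all times forces \<open>X Y = Z\<^sup>2\<close> if both numbers are at most 1, and if \<open>Z\<^sup>2 > 1\<close>, then the
  inequality \<open>\<mu>\<^sup>2 \<le> \<lambda> \<nu>\<close> for all roots in the sequence, whose coefficients grow like products
  along the two orbits, forces \<open>Z\<^sup>2 \<le> X Y\<close> (\<open>logistic_le_of_itinerary_and_growth\<close>,
  \<open>root_triple_pairing_bound\<close>).
\<close>

section \<open>Length and ascents in a Coxeter group\<close>

text \<open>
  The alternating word \<open>\<dots> s t s t\<close> of length \<open>k\<close> is indexed by its last letter \<open>t\<close>: the words
  grow to the left, as they do when letters are peeled off the right end of a group element.
\<close>

fun alt_word :: "'s \<Rightarrow> 's \<Rightarrow> nat \<Rightarrow> 's list" where
  "alt_word s t 0 = []"
| "alt_word s t (Suc k) = (if even k then t else s) # alt_word s t k"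

lemma length_alt_word [simp]: "length (alt_word s t k) = k"
  by (induction k) auto

lemma alt_word_in_lists: "s \<in> S \<Longrightarrow> t \<in> S \<Longrightarrow> alt_word s t k \<in> lists S"
  by (induction k) auto

lemma alt_word_double: "alt_word s t (2 * n) = concat (replicate n [s, t])"
  by (induction n) auto

lemma alt_word_add:
  assumes "s \<in> S" "t \<in> S"
  obtains u where "u \<in> lists S" "length u = i" "alt_word s t (i + j) = u @ alt_word s t j"
proof -
  have "\<exists>u\<in>lists S. length u = i \<and> alt_word s t (i + j) = u @ alt_word s t j"
  proof (induction i)
    case (Suc i)
    then obtain u where "u \<in> lists S" "length u = i" "alt_word s t (i + j) = u @ alt_word s t j"
      by blast
    then show ?case
      using assms by (intro bexI[of _ "(if even (i + j) then t else s) # u"]) auto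
  qed auto
  then show ?thesis using that by blast
qed

definition coxeter_length :: "'s set \<Rightarrow> ('s \<Rightarrow> 's \<Rightarrow> enat) \<Rightarrow> 's list \<Rightarrow> nat" where
  "coxeter_length S m w = (LEAST n. \<exists>w'. coxeter_eq S m w w' \<and> length w' = n)"

lemma coxeter_length_cong:
  assumes "coxeter_eq S m w w'"
  shows "coxeter_length S m w = coxeter_length S m w'"
proof -
  have "coxeter_eq S m w x \<longleftrightarrow> coxeter_eq S m w' x" for x
    by (metis assms coxeter_sym coxeter_trans)
  then show ?thesis by (simp only: coxeter_length_def)
qed

lemma coxeter_length_le_length: "coxeter_eq S m w w' \<Longrightarrow> coxeter_length S m w \<le> length w'"
  unfolding coxeter_length_def by (rule Least_le) blast

lemma reduced_word_exists:
  assumes "w \<in> lists S"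
  obtains w' where "coxeter_eq S m w w'" "length w' = coxeter_length S m w"
proof -
  have "\<exists>n w'. coxeter_eq S m w w' \<and> length w' = n"
    using coxeter_refl[OF assms] by blast
  then have "\<exists>w'. coxeter_eq S m w w' \<and> length w' = coxeter_length S m w"
    unfolding coxeter_length_def by (rule LeastI_ex)
  then show ?thesis using that by blast
qed

lemma coxeter_length_append_le:
  assumes "u \<in> lists S" "v \<in> lists S"
  shows "coxeter_length S m (u @ v) \<le> coxeter_length S m u + length v"
proof -
  obtain u' where u': "coxeter_eq S m u u'" "length u' = coxeter_length S m u"
    using reduced_word_exists[OF assms(1)] by blast
  have "coxeter_eq S m (u @ v) (u' @ v)"
    using coxeter_eq_context[OF u'(1), of "[]" v] assms by simp
  then show ?thesis using coxeter_length_le_length[of S m "u @ v" "u' @ v"] u'(2) by simp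
qed

context coxeter_parameters
begin

lemma gen_gen_cancel:
  assumes "s \<in> S" "u \<in> lists S" "v \<in> lists S"
  shows "coxeter_eq S m (u @ [s, s] @ v) (u @ v)"
  using coxeter_rel[of s S s m 1 u v] assms by (simp add: m_diag one_enat_def)

lemma rev_append_cancel:
  assumes "w \<in> lists S"
  shows "coxeter_eq S m (rev w @ w) []"
  using assms
proof (induction w)
  case (Cons s w)
  have "coxeter_eq S m (rev w @ [s, s] @ w) (rev w @ w)"
    using Cons by (intro gen_gen_cancel) auto
  then show ?case using Cons coxeter_trans[of S m "rev w @ [s, s] @ w" "rev w @ w" "[]"] by auto
qed (auto intro: coxeter_refl)

text \<open>
  The relation splits \<open>(s t)\<^sup>n\<close> into two halves of length \<open>n\<close>, which are therefore inverse to
  each other. The reversal of the first half ends in \<open>s\<close>, which makes \<open>s\<close> a descent of the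
  second half.
\<close>

lemma alt_word_descent:
  assumes "s \<in> S" "t \<in> S" "m s t = enat n" "n \<ge> 1"
  obtains y where "y \<in> lists S" "Suc (length y) = n" "coxeter_eq S m (alt_word s t n @ [s]) y"
proof -
  obtain x where x: "x \<in> lists S" "length x = n" "alt_word s t (n + n) = x @ alt_word s t n"
    using alt_word_add[OF assms(1,2), of n n] by blast
  have alt: "alt_word s t n \<in> lists S" by (intro alt_word_in_lists assms)
  have xalt: "x @ alt_word s t n = concat (replicate n [s, t])"
    using alt_word_double[of s t n] x(3) by (simp add: mult_2)
  then have "hd x = s" using x(2) assms(4) by (cases x; cases n) simp_all
  then obtain y where y: "x = s # y" using x(2) assms(4) by (cases x) auto
  have yS: "rev y \<in> lists S" "rev x \<in> lists S" using x(1) y by auto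
  have "coxeter_eq S m (rev x @ x @ alt_word s t n) (alt_word s t n)"
    using coxeter_eq_context[OF rev_append_cancel[OF x(1)], of "[]" "alt_word s t n"] alt by simp
  moreover have "coxeter_eq S m (rev x @ x @ alt_word s t n) (rev x)"
    using coxeter_rel[of s S t m n "rev x" "[]"] assms xalt yS by simp
  ultimately have half: "coxeter_eq S m (alt_word s t n) (rev x)"
    by (rule coxeter_trans[OF coxeter_sym])
  have "coxeter_eq S m (alt_word s t n @ [s]) (rev x @ [s])"
    using coxeter_eq_context[OF half, of "[]" "[s]"] assms(1) by simp
  moreover have "coxeter_eq S m (rev x @ [s]) (rev y)"
    using gen_gen_cancel[of s "rev y" "[]"] yS y assms(1) by simp
  ultimately have "coxeter_eq S m (alt_word s t n @ [s]) (rev y)" by (rule coxeter_trans)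
  then show ?thesis using that[of "rev y"] yS y x(2) by simp
qed

text \<open>
  An induction principle for statements about all pairs \<open>(w, s)\<close> for which \<open>s\<close> is not a
  descent of \<open>w\<close>. If \<open>w \<noteq> 1\<close>, let \<open>t \<noteq> s\<close> be a descent of \<open>w\<close>, and peel the letters \<open>t, s, t,
  \<dots>\<close> off the right end of \<open>w\<close> for as long as this shortens it. What remains is a shorter
  element \<open>v\<close> with neither \<open>s\<close> nor \<open>t\<close> as a descent. Fewer than \<open>m s t\<close> letters were peeled
  off, as otherwise the braid relation would make \<open>s\<close> a descent of \<open>w\<close>.
\<close>

lemma ascent_induct [consumes 3, case_names cong one dihedral]:
  assumes "w \<in> lists S" "s \<in> S"
    and "\<not> coxeter_length S m (w @ [s]) < coxeter_length S m w"
    and cong: "\<And>w w' s. \<lbrakk>coxeter_eq S m w w'; s \<in> S; P w s\<rbrakk> \<Longrightarrow> P w' s"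
    and one: "\<And>s. s \<in> S \<Longrightarrow> P [] s"
    and dihedral: "\<And>v s t k. \<lbrakk>v \<in> lists S; s \<in> S; t \<in> S; s \<noteq> t; enat k < m s t; P v s; P v t\<rbrakk>
      \<Longrightarrow> P (v @ alt_word s t k) s"
  shows "P w s"
  using assms(1-3)
proof (induction "coxeter_length S m w" arbitrary: w s rule: less_induct)
  case less
  note w = \<open>w \<in> lists S\<close> and s = \<open>s \<in> S\<close>
  let ?l = "coxeter_length S m"
  obtain w' where w': "coxeter_eq S m w w'" "length w' = ?l w"
    using reduced_word_exists[OF w] by blast
  have w'S: "w' \<in> lists S" using coxeter_eq_lists[OF w'(1)] by blast
  show ?case
  proof (cases w' rule: rev_cases)
    case Nil
    then show ?thesis using cong[OF coxeter_sym[OF w'(1)] s] one[OF s] by simp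
  next
    case (snoc w1 t)
    have t: "t \<in> S" and w1: "w1 \<in> lists S" using w'S snoc by auto
    have lw1: "?l w1 + 1 = ?l w"
    proof -
      have "?l w \<le> ?l w1 + 1"
        using coxeter_length_cong[OF w'(1)] coxeter_length_append_le[of w1 S "[t]" m] snoc t w1
        by simp
      moreover have "?l w1 \<le> length w1"
        by (rule coxeter_length_le_length[OF coxeter_refl[OF w1]])
      ultimately show ?thesis using w'(2) snoc by simp
    qed
    have "s \<noteq> t"
    proof
      assume "s = t"
      then have "coxeter_eq S m (w @ [s]) (w1 @ [s, s])"
        using coxeter_eq_context[OF w'(1), of "[]" "[s]"] snoc s by simp
      moreover have "coxeter_eq S m (w1 @ [s, s]) w1"
        using gen_gen_cancel[of s w1 "[]"] s w1 by simp
      ultimately have "?l (w @ [s]) = ?l w1"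
        by (intro coxeter_length_cong) (rule coxeter_trans)
      then show False using lw1 less.prems(3) by simp
    qed
    define D where "D k \<longleftrightarrow> (\<exists>v\<in>lists S. coxeter_eq S m w (v @ alt_word s t k) \<and> ?l v + k = ?l w)" for k
    have "D 1" using w'(1) w1 lw1 snoc by (auto simp: D_def intro!: bexI[of _ w1])
    moreover have D_bound: "D k \<Longrightarrow> k \<le> ?l w" for k by (auto simp: D_def)
    ultimately obtain k where k: "D k" "\<And>j. D j \<Longrightarrow> j \<le> k"
      using Nat.ex_has_greatest_nat[of D 1 "?l w"] by blast
    have k1: "k \<ge> 1" using k(2) \<open>D 1\<close> .
    obtain v where v: "v \<in> lists S" "coxeter_eq S m w (v @ alt_word s t k)" "?l v + k = ?l w"
      using k(1) by (auto simp: D_def)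
    \<comment> \<open>\<open>p\<close> would be the next letter to peel off, \<open>q\<close> is the last one that was.\<close>
    define p where "p = (if even k then t else s)"
    define q where "q = (if even k then s else t)"
    have pq: "p \<in> S" "q \<in> S" using s t by (auto simp: p_def q_def)
    have p: "\<not> ?l (v @ [p]) < ?l v"
    proof
      assume less_v: "?l (v @ [p]) < ?l v"
      have "coxeter_eq S m (v @ [p, p] @ alt_word s t k) (v @ alt_word s t k)"
        by (intro gen_gen_cancel pq v alt_word_in_lists s t)
      then have eq: "coxeter_eq S m w ((v @ [p]) @ alt_word s t (Suc k))"
        using coxeter_trans[OF v(2) coxeter_sym] by (simp add: p_def)
      have "?l w \<le> ?l (v @ [p]) + Suc k"
        using coxeter_length_cong[OF eq] coxeter_length_append_le[of "v @ [p]" S "alt_word s t (Suc k)" m]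
          v(1) pq(1) alt_word_in_lists[OF s t, of "Suc k"] by simp
      then have "D (Suc k)"
        unfolding D_def using less_v eq v pq by (intro bexI[of _ "v @ [p]"]) auto
      then show False using k(2) by fastforce
    qed
    have q: "\<not> ?l (v @ [q]) < ?l v"
    proof -
      obtain j where j: "k = Suc j" using k1 by (cases k) auto
      have "v @ alt_word s t k = (v @ [q]) @ alt_word s t j" by (simp add: j q_def)
      then have "?l w \<le> ?l (v @ [q]) + j"
        using coxeter_length_cong[OF v(2)] coxeter_length_append_le[of "v @ [q]" S "alt_word s t j" m]
          v(1) pq(2) alt_word_in_lists[OF s t, of j] by simp
      then show ?thesis using v(3) j by simp
    qed
    have "?l v < ?l w" using v(3) k1 by simp
    then have "P v p" "P v q"
      using less.hyps[OF _ v(1) pq(1) p] less.hyps[OF _ v(1) pq(2) q] by simp_all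
    then have Pv: "P v s" "P v t" by (auto simp: p_def q_def split: if_splits)
    have "enat k < m s t"
    proof (rule ccontr)
      assume "\<not> enat k < m s t"
      then obtain n where n: "m s t = enat n" "n \<le> k" by (cases "m s t") auto
      have "n \<ge> 1" using m_off_diag[OF s t \<open>s \<noteq> t\<close>] n(1) by (simp add: numeral_eq_enat)
      then obtain y where y: "y \<in> lists S" "Suc (length y) = n"
        "coxeter_eq S m (alt_word s t n @ [s]) y"
        using alt_word_descent[OF s t n(1)] by blast
      obtain u where u: "u \<in> lists S" "length u = k - n" "alt_word s t k = u @ alt_word s t n"
        using alt_word_add[OF s t, of "k - n" n] n(2) by auto
      have "coxeter_eq S m (w @ [s]) ((v @ u) @ alt_word s t n @ [s])"
        using coxeter_eq_context[OF v(2), of "[]" "[s]"] s u(3) by simp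
      moreover have "coxeter_eq S m ((v @ u) @ alt_word s t n @ [s]) ((v @ u) @ y)"
        using coxeter_eq_context[OF y(3), of "v @ u" "[]"] v(1) u(1) by simp
      ultimately have "coxeter_eq S m (w @ [s]) ((v @ u) @ y)" by (rule coxeter_trans)
      then have "?l (w @ [s]) = ?l (v @ u @ y)" using coxeter_length_cong by fastforce
      also have "\<dots> \<le> ?l v + length (u @ y)"
        using v(1) u(1) y(1) by (intro coxeter_length_append_le) auto
      also have "\<dots> < ?l w" using v(3) u(2) y(2) n(2) by simp
      finally show False using less.prems(3) by simp
    qed
    then show ?thesis
      by (intro cong[OF coxeter_sym[OF v(2)] s] dihedral v(1) s t \<open>s \<noteq> t\<close> Pv)
  qed
qed

end

section \<open>Words of reflections for a possibly asymmetric bilinear form\<close>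

text \<open>
  These are the Chebyshev values \<open>sin (k \<theta>) / sin \<theta>\<close> for \<open>p = cos\<^sup>2 \<theta>\<close>, divided by \<open>cos \<theta>\<close>
  when \<open>k\<close> is even. This normalization makes them polynomials in \<open>p\<close>. In a rank two root
  system with \<open>p = G (e s) (e t) * G (e t) (e s)\<close>, the coefficients of the roots then depend
  on \<open>p\<close> alone, up to one factor \<open>- G (e s) (e t)\<close>.
\<close>

fun dihedral_coeff :: "real \<Rightarrow> nat \<Rightarrow> real" where
  "dihedral_coeff p 0 = 0"
| "dihedral_coeff p (Suc 0) = 1"
| "dihedral_coeff p (Suc (Suc k)) =
     (if even k then 2 else 2 * p) * dihedral_coeff p (Suc k) - dihedral_coeff p k"

lemma dihedral_coeff_sin:
  "sin \<theta> * (if odd k then 1 else cos \<theta>) * dihedral_coeff ((cos \<theta>)\<^sup>2) k = sin (real k * \<theta>)"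
proof (induction "(cos \<theta>)\<^sup>2" k rule: dihedral_coeff.induct)
  case (3 k)
  have "sin (real (Suc (Suc k)) * \<theta>) = sin (real (Suc k) * \<theta> + \<theta>)"
    by (simp add: algebra_simps)
  moreover have "sin (real k * \<theta>) = sin (real (Suc k) * \<theta> - \<theta>)"
    by (simp add: algebra_simps)
  ultimately have rec:
    "sin (real (Suc (Suc k)) * \<theta>) = 2 * cos \<theta> * sin (real (Suc k) * \<theta>) - sin (real k * \<theta>)"
    unfolding sin_add sin_diff by simp
  show ?case
    unfolding rec 3[symmetric] by (simp add: algebra_simps power2_eq_square)
qed auto

lemma dihedral_coeff_nonneg_finite:
  assumes "2 \<le> n" "k \<le> n"
  shows "0 \<le> dihedral_coeff ((cos (pi / real n))\<^sup>2) k"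
proof (cases "n = 2")
  case True
  then have "k = 0 \<or> k = 1 \<or> k = 2" using assms by auto
  then show ?thesis using True by (auto simp: numeral_2_eq_2)
next
  case False
  let ?\<theta> = "pi / real n"
  let ?K = "sin ?\<theta> * (if odd k then 1 else cos ?\<theta>)"
  have "0 < sin ?\<theta>" using assms by (intro sin_gt_zero) (auto simp: field_simps)
  moreover have "0 < cos ?\<theta>" using assms False by (intro cos_gt_zero) (auto simp: field_simps)
  ultimately have "0 < ?K" by simp
  moreover have "0 \<le> sin (real k * ?\<theta>)" using assms by (intro sin_ge_zero) (auto simp: field_simps)
  then have "?K * 0 \<le> ?K * dihedral_coeff ((cos ?\<theta>)\<^sup>2) k"
    by (simp only: dihedral_coeff_sin mult_zero_right)
  ultimately show ?thesis by (simp only: mult_le_cancel_left_pos)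
qed

lemma dihedral_coeff_nonneg_infinite:
  assumes "1 \<le> p"
  shows "0 \<le> dihedral_coeff p k"
proof -
  have "0 \<le> dihedral_coeff p k \<and> dihedral_coeff p k \<le> dihedral_coeff p (Suc k)"
  proof (induction k)
    case (Suc k)
    have "dihedral_coeff p (Suc k) \<le> p * dihedral_coeff p (Suc k)"
      using Suc assms mult_right_mono[of 1 p "dihedral_coeff p (Suc k)"] by simp
    then show ?case using Suc by auto
  qed auto
  then show ?thesis ..
qed

definition refl_word :: "('v::real_vector \<Rightarrow> 'v \<Rightarrow> real) \<Rightarrow> ('s \<Rightarrow> 'v) \<Rightarrow> 's list \<Rightarrow> 'v \<Rightarrow> 'v" where
  "refl_word G e w = foldr (\<lambda>s x. x - (2 * G x (e s)) *\<^sub>R e s) w"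

lemma refl_word_Nil [simp]: "refl_word G e [] x = x"
  and refl_word_Cons: "refl_word G e (s # w) x
    = refl_word G e w x - (2 * G (refl_word G e w x) (e s)) *\<^sub>R e s"
  and refl_word_append: "refl_word G e (u @ v) x = refl_word G e u (refl_word G e v x)"
  by (simp_all add: refl_word_def)

text \<open>
  One side of a Coxeter datum, with the form allowed to be asymmetric. The reflections \<open>x - 2
  G(x, e\<^sub>s) e\<^sub>s\<close> of \<open>G\<close> and those of the flipped form are adjoint to each other under \<open>G\<close>, so
  flipping the form exchanges the two sides.
\<close>

locale cartan_form = coxeter_parameters S m
  for S :: "'s set" and m :: "'s \<Rightarrow> 's \<Rightarrow> enat" +
  fixes G :: "'v::real_vector \<Rightarrow> 'v \<Rightarrow> real" and e :: "'s \<Rightarrow> 'v"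
  assumes G_bilinear: "bilinear G"
    and G_diag: "s \<in> S \<Longrightarrow> G (e s) (e s) = 1"
    and G_off_diag: "\<lbrakk>s \<in> S; t \<in> S; s \<noteq> t\<rbrakk> \<Longrightarrow> G (e s) (e t) \<le> 0"
    and G_finite: "\<lbrakk>s \<in> S; t \<in> S; m s t = enat n\<rbrakk>
      \<Longrightarrow> G (e s) (e t) * G (e t) (e s) = (cos (pi / real n))\<^sup>2"
    and G_infinite: "\<lbrakk>s \<in> S; t \<in> S; m s t = \<infinity>\<rbrakk> \<Longrightarrow> 1 \<le> G (e s) (e t) * G (e t) (e s)"
    and G_zero: "\<lbrakk>s \<in> S; t \<in> S; G (e s) (e t) = 0\<rbrakk> \<Longrightarrow> G (e t) (e s) = 0"
begin

lemmas G_simps =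
  bilinear_ladd[OF G_bilinear] bilinear_radd[OF G_bilinear]
  bilinear_lsub[OF G_bilinear] bilinear_rsub[OF G_bilinear]
  bilinear_lmul[OF G_bilinear] bilinear_rmul[OF G_bilinear]

lemma cartan_form_flip: "cartan_form S m (\<lambda>x y. G y x) e"
proof
  show "bilinear (\<lambda>x y. G y x)" using G_bilinear by (simp add: bilinear_def)
qed (use G_diag G_off_diag G_finite G_infinite G_zero m_sym in \<open>auto simp: mult.commute\<close>)

lemma refl_word_linear: "linear (refl_word G e w)"
proof (induction w)
  case Nil
  then show ?case by (simp add: refl_word_def id_def[symmetric] linear_id)
next
  case (Cons s w)
  then show ?case
    by (intro linearI) (simp_all add: refl_word_Cons linear_add linear_scale G_simps algebra_simps)
qed

lemma refl_word_singleton: "refl_word G e [s] x = x - (2 * G x (e s)) *\<^sub>R e s"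
  by (simp add: refl_word_Cons)

lemma refl_refl: "s \<in> S \<Longrightarrow> refl_word G e [s, s] x = x"
  by (simp add: refl_word_Cons G_simps G_diag algebra_simps)

lemma refl_word_rev: "w \<in> lists S \<Longrightarrow> refl_word G e w (refl_word G e (rev w) x) = x"
proof (induction w arbitrary: x)
  case (Cons s w)
  then show ?case by (simp add: refl_word_append refl_word_Cons G_simps G_diag algebra_simps)
qed simp

lemma refl_word_alt_word:
  assumes "s \<in> S" "t \<in> S"
  shows "refl_word G e (alt_word s t k) (e s)
    = dihedral_coeff (G (e s) (e t) * G (e t) (e s)) (if even k then Suc k else k) *\<^sub>R e s
    + (- G (e s) (e t) * dihedral_coeff (G (e s) (e t) * G (e t) (e s)) (if even k then k else Suc k)) *\<^sub>R e t"
proof (induction k)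
  case (Suc k)
  show ?case
    unfolding alt_word.simps refl_word_Cons Suc.IH
    using assms
    by (cases "even k"; simp add: G_simps G_diag algebra_simps)
      (simp_all add: scaleR_left_distrib[symmetric])
qed simp

lemma braid_fixes_root:
  assumes "s \<in> S" "t \<in> S" "m s t = enat n" "2 \<le> n"
  shows "refl_word G e (concat (replicate n [s, t])) (e s) = e s"
proof -
  let ?\<theta> = "pi / real n"
  let ?d = "dihedral_coeff (G (e s) (e t) * G (e t) (e s))"
  have sin: "0 < sin ?\<theta>" using assms(4) by (intro sin_gt_zero) (auto simp: field_simps)
  have p: "G (e s) (e t) * G (e t) (e s) = (cos ?\<theta>)\<^sup>2" using G_finite assms by blast
  have "real (Suc (2 * n)) * ?\<theta> = ?\<theta> + 2 * pi" using assms(4) by (simp add: field_simps)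
  then have "sin (real (Suc (2 * n)) * ?\<theta>) = sin ?\<theta>" by (simp only: sin_periodic)
  then have "sin ?\<theta> * ?d (Suc (2 * n)) = sin ?\<theta>"
    using dihedral_coeff_sin[of ?\<theta> "Suc (2 * n)"] unfolding p by simp
  then have 1: "?d (Suc (2 * n)) = 1" using sin by simp
  have "real (2 * n) * ?\<theta> = 2 * pi" using assms(4) by simp
  then have "sin (real (2 * n) * ?\<theta>) = 0" by (simp only: sin_two_pi)
  then have "cos ?\<theta> = 0 \<or> ?d (2 * n) = 0"
    using dihedral_coeff_sin[of ?\<theta> "2 * n"] sin unfolding p by simp
  moreover have "G (e s) (e t) = 0" if "cos ?\<theta> = 0"
    using p that G_zero[OF assms(2,1)] by auto
  ultimately have "G (e s) (e t) * ?d (2 * n) = 0" by auto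
  then show ?thesis
    using refl_word_alt_word[OF assms(1,2), of "2 * n"] 1 by (simp add: alt_word_double)
qed

text \<open>
  On the plane of \<open>e s\<close> and \<open>e t\<close> the relation holds because it fixes both vectors. The form
  is nondegenerate on that plane since \<open>cos\<^sup>2 (\<pi> / n) < 1\<close>, so every vector is the sum of one
  in the plane and one on which both reflections act trivially.
\<close>

lemma braid_relation:
  assumes "s \<in> S" "t \<in> S" "m s t = enat n"
  shows "refl_word G e (concat (replicate n [s, t])) x = x"
proof (cases "s = t")
  case True
  then have "n = 1" using assms m_diag by (simp add: one_enat_def)
  then show ?thesis using True refl_refl assms by simp
next
  case False
  then have n: "2 \<le> n" using m_off_diag[OF assms(1,2)] assms(3) by (simp add: numeral_eq_enat)
  let ?T = "refl_word G e (concat (replicate n [s, t]))"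
  have Ts: "?T (e s) = e s" using braid_fixes_root assms n by blast
  have rev: "rev (concat (replicate k [s, t])) = concat (replicate k [t, s])" for k
    by (simp add: rev_concat)
  have "concat (replicate n [s, t]) \<in> lists S"
    unfolding alt_word_double[symmetric] by (intro alt_word_in_lists assms)
  then have "?T (refl_word G e (concat (replicate n [t, s])) (e t)) = e t"
    using refl_word_rev[of "concat (replicate n [s, t])" "e t"] by (simp only: rev)
  then have Tt: "?T (e t) = e t"
    using braid_fixes_root[of t s n] assms n m_sym[OF assms(1,2)] by simp
  let ?A = "G (e t) (e s)" and ?C = "G (e s) (e t)"
  have "0 < sin (pi / real n)" using n by (intro sin_gt_zero) (auto simp: field_simps)
  moreover have "1 - ?A * ?C = (sin (pi / real n))\<^sup>2"
    using G_finite[OF assms] by (simp add: sin_squared_eq mult.commute)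
  ultimately have D: "1 - ?A * ?C \<noteq> 0" by simp
  \<comment> \<open>the solution of the linear system that makes \<open>y\<close> orthogonal to \<open>e s\<close> and \<open>e t\<close>\<close>
  define p where "p = (G x (e s) - ?A * G x (e t)) / (1 - ?A * ?C)"
  define q where "q = (G x (e t) - ?C * G x (e s)) / (1 - ?A * ?C)"
  define y where "y = x - p *\<^sub>R e s - q *\<^sub>R e t"
  have "p + q * ?A = G x (e s)" "p * ?C + q = G x (e t)"
    using D by (simp_all add: p_def q_def divide_simps) (simp_all add: algebra_simps)
  then have y0: "G y (e s) = 0" "G y (e t) = 0"
    using assms by (simp_all add: y_def G_simps G_diag algebra_simps)
  have "refl_word G e (concat (replicate k [s, t])) y = y" for k
    by (induction k) (simp_all add: refl_word_Cons y0)
  then have "?T (y + p *\<^sub>R e s + q *\<^sub>R e t) = y + p *\<^sub>R e s + q *\<^sub>R e t"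
    by (simp add: linear_add[OF refl_word_linear] linear_scale[OF refl_word_linear] Ts Tt)
  then show ?thesis by (simp add: y_def)
qed

lemma refl_word_cong: "coxeter_eq S m w w' \<Longrightarrow> refl_word G e w = refl_word G e w'"
proof (induction rule: coxeter_eq.induct)
  case (coxeter_rel s t n u v)
  then show ?case by (intro ext) (simp add: refl_word_append braid_relation)
qed auto

text \<open>
  The invariance of the pairing: every reflection is an involution adjoint to its partner for
  the flipped form.
\<close>

lemma refl_word_adjoint:
  assumes "w \<in> lists S"
  shows "G (refl_word G e w x) (refl_word (\<lambda>x y. G y x) e w y) = G x y"
  using assms
proof (induction w)
  case (Cons s w)
  then show ?case by (simp add: refl_word_Cons G_simps G_diag algebra_simps)
qed simp

lemma refl_word_move:
  assumes "w \<in> lists S"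
  shows "G (refl_word G e v x) (refl_word (\<lambda>x y. G y x) e w y) = G (refl_word G e (rev w @ v) x) y"
  using refl_word_adjoint[OF assms, of "refl_word G e (rev w @ v) x" y]
    refl_word_rev[OF assms, of "refl_word G e v x"]
  by (simp add: refl_word_append)

text \<open>
  The reflection in an arbitrary root \<open>w e\<^sub>s\<close> needs the partner of that root for the flipped
  form as its coroot.
\<close>

lemma refl_word_conjugate:
  assumes "w \<in> lists S" "s \<in> S"
  shows "refl_word G e (w @ [s] @ rev w) x
    = x - (2 * G x (refl_word (\<lambda>x y. G y x) e w (e s))) *\<^sub>R refl_word G e w (e s)"
proof -
  let ?y = "refl_word G e (rev w) x"
  have "G ?y (e s) = G x (refl_word (\<lambda>x y. G y x) e w (e s))"
    using refl_word_adjoint[OF assms(1), of ?y "e s"] refl_word_rev[OF assms(1), of x] by simp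
  moreover have "refl_word G e (w @ [s] @ rev w) x = refl_word G e w (?y - (2 * G ?y (e s)) *\<^sub>R e s)"
    by (simp add: refl_word_append refl_word_Cons)
  ultimately show ?thesis
    by (simp add: linear_diff[OF refl_word_linear] linear_scale[OF refl_word_linear] refl_word_rev[OF assms(1)])
qed

end

section \<open>Orbits of the logistic map\<close>

text \<open>
  The map \<open>x \<mapsto> (1 - 2 x)\<^sup>2\<close> sends \<open>cos\<^sup>2 \<theta>\<close> to \<open>cos\<^sup>2 (2 \<theta>)\<close>. In the coordinate \<open>2 \<theta> \<in> [0, \<pi>]\<close>
  it is the tent map, which doubles the distance of any two points on the same side of the
  fold. Two orbits that always agree on the side must therefore coincide.
\<close>

lemma logistic_itinerary_inj:
  fixes q z :: "nat \<Rightarrow> real"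
  assumes q: "\<And>n. q (Suc n) = (1 - 2 * q n)\<^sup>2" and z: "\<And>n. z (Suc n) = (1 - 2 * z n)\<^sup>2"
    and "0 \<le> q 0" "q 0 \<le> 1" "0 \<le> z 0" "z 0 \<le> 1"
    and sgn: "\<And>n. sgn (1 - 2 * q n) = sgn (1 - 2 * z n)"
  shows "q 0 = z 0"
proof -
  define a where "a n = arccos (2 * q n - 1)" for n
  define b where "b n = arccos (2 * z n - 1)" for n
  have angle: "2 * y - 1 = cos (arccos (2 * y - 1)) \<and> 0 \<le> arccos (2 * y - 1) \<and> arccos (2 * y - 1) \<le> pi
      \<and> arccos (2 * (1 - 2 * y)\<^sup>2 - 1)
        = (if 1 - 2 * y \<le> 0 then 2 * arccos (2 * y - 1) else 2 * pi - 2 * arccos (2 * y - 1))"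
    if y: "0 \<le> y" "y \<le> 1" for y :: real
  proof -
    let ?t = "arccos (2 * y - 1)"
    have t: "cos ?t = 2 * y - 1" "0 \<le> ?t" "?t \<le> pi"
      using y by (auto intro!: cos_arccos arccos_lbound arccos_ubound)
    have "2 * (1 - 2 * y)\<^sup>2 - 1 = cos (2 * ?t)"
      unfolding cos_double_cos t(1) by (simp add: power2_eq_square algebra_simps)
    moreover have "arccos (cos (2 * ?t)) = 2 * ?t" if "1 - 2 * y \<le> 0"
    proof -
      have "?t \<le> arccos 0" using that y by (intro arccos_le_arccos) auto
      then show ?thesis using t by (intro arccos_cos) (simp_all add: arccos_0)
    qed
    moreover have "arccos (cos (2 * ?t)) = 2 * pi - 2 * ?t" if "\<not> 1 - 2 * y \<le> 0"
    proof -
      have "arccos 0 \<le> ?t" using that y by (intro arccos_le_arccos) auto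
      then have "arccos (cos (2 * pi - 2 * ?t)) = 2 * pi - 2 * ?t"
        using t by (intro arccos_cos) (simp_all add: arccos_0)
      then show ?thesis by (simp add: cos_diff)
    qed
    ultimately show ?thesis using t by simp
  qed
  have unit: "0 \<le> q n \<and> q n \<le> 1 \<and> 0 \<le> z n \<and> z n \<le> 1" for n
  proof (induction n)
    case (Suc n)
    have "\<bar>1 - 2 * q n\<bar> \<le> 1" "\<bar>1 - 2 * z n\<bar> \<le> 1" using Suc by auto
    then show ?case unfolding q z using abs_square_le_1 by auto
  qed (use assms in auto)
  have step: "\<bar>a (Suc n) - b (Suc n)\<bar> = 2 * \<bar>a n - b n\<bar>" for n
  proof -
    have "1 - 2 * q n \<le> 0 \<longleftrightarrow> 1 - 2 * z n \<le> 0" using sgn[of n] by (auto simp: sgn_if split: if_splits)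
    moreover have "a (Suc n) = (if 1 - 2 * q n \<le> 0 then 2 * a n else 2 * pi - 2 * a n)"
      "b (Suc n) = (if 1 - 2 * z n \<le> 0 then 2 * b n else 2 * pi - 2 * b n)"
      using angle[of "q n"] angle[of "z n"] unit[of n] unfolding a_def b_def q z by blast+
    ultimately show ?thesis by (simp add: abs_if)
  qed
  have "\<bar>a n - b n\<bar> = 2 ^ n * \<bar>a 0 - b 0\<bar>" for n
    by (induction n) (simp_all add: step)
  moreover have "\<bar>a n - b n\<bar> \<le> pi" for n
    using angle[of "q n"] angle[of "z n"] unit[of n] unfolding a_def b_def by auto
  ultimately have bound: "2 ^ n * \<bar>a 0 - b 0\<bar> \<le> pi" for n by metis
  have "a 0 = b 0"
  proof (rule ccontr)
    assume ne: "a 0 \<noteq> b 0"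
    obtain n where "pi / \<bar>a 0 - b 0\<bar> < 2 ^ n" using real_arch_pow[of 2] by auto
    then show False using bound[of n] ne by (simp add: field_simps)
  qed
  then show ?thesis using angle[of "q 0"] angle[of "z 0"] assms(3-6) by (simp add: a_def b_def)
qed

text \<open>
  If \<open>z 0 \<le> 1\<close>, an orbit with \<open>q 0 < z 0\<close> and the same itinerary is excluded by the previous
  lemma. If \<open>z 0 > 1\<close>, the itinerary is that of the fixed point 1, so the same lemma yields \<open>1
  \<le> q 0\<close>. Above 1 itineraries carry no information, but there the ratio \<open>z n / q n\<close> never
  decreases, so \<open>q 0 < z 0\<close> would make the quotient of the two products grow exponentially.
\<close>

lemma logistic_le_of_itinerary_and_growth:
  fixes q z :: "nat \<Rightarrow> real"
  assumes q: "\<And>n. q (Suc n) = (1 - 2 * q n)\<^sup>2" and z: "\<And>n. z (Suc n) = (1 - 2 * z n)\<^sup>2"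
    and "0 \<le> q 0" "0 \<le> z 0"
    and sgn: "\<And>n. sgn (1 - 2 * q n) = sgn (1 - 2 * z n)"
    and "0 < b" and growth: "\<And>n. b * (\<Prod>i<n. z i) \<le> a * (\<Prod>i<n. q i)"
  shows "z 0 \<le> q 0"
proof (rule ccontr)
  assume "\<not> z 0 \<le> q 0"
  then have less: "q 0 < z 0" by simp
  show False
  proof (cases "z 0 \<le> 1")
    case True
    then show False using logistic_itinerary_inj[of q z] q z sgn less assms(3,4) by simp
  next
    case False
    have z1: "1 < z n" for n
    proof (induction n)
      case (Suc n)
      then have "1 < (2 * z n - 1)\<^sup>2" by (simp add: one_less_power)
      then show ?case unfolding z by (simp add: power2_commute)
    qed (use False in simp)
    have "1 \<le> q 0"
    proof (rule ccontr)
      assume "\<not> 1 \<le> q 0"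
      moreover have "sgn (1 - 2 * q n) = sgn (1 - 2 * 1)" for n
        unfolding sgn[of n] using z1[of n] by (simp add: sgn_if)
      ultimately show False
        using logistic_itinerary_inj[of q "\<lambda>n. 1"] q assms(3) by simp
    qed
    define \<rho> where "\<rho> = z 0 / q 0"
    have \<rho>: "1 < \<rho>" using less \<open>1 \<le> q 0\<close> by (simp add: \<rho>_def)
    have ratio: "1 \<le> q n \<and> \<rho> * q n \<le> z n" for n
    proof (induction n)
      case 0
      then show ?case using \<open>1 \<le> q 0\<close> by (simp add: \<rho>_def)
    next
      case (Suc n)
      have 1: "1 \<le> 2 * q n - 1" using Suc by simp
      then have "1 \<le> (2 * q n - 1)\<^sup>2" by (rule one_le_power)
      moreover have "\<rho> * (2 * q n - 1)\<^sup>2 \<le> (2 * z n - 1)\<^sup>2"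
      proof -
        have "\<rho> * (2 * q n - 1) \<le> 2 * z n - 1" using Suc \<rho> by (simp add: algebra_simps)
        then have "(\<rho> * (2 * q n - 1))\<^sup>2 \<le> (2 * z n - 1)\<^sup>2"
          using 1 \<rho> by (intro power_mono) auto
        moreover have "\<rho> * (2 * q n - 1)\<^sup>2 \<le> \<rho>\<^sup>2 * (2 * q n - 1)\<^sup>2"
          using \<rho> by (intro mult_right_mono) (simp_all add: power2_eq_square)
        ultimately show ?thesis by (simp add: power_mult_distrib)
      qed
      ultimately show ?case unfolding q z by (simp add: power2_commute)
    qed
    have prods: "1 \<le> (\<Prod>i<n. q i) \<and> \<rho> ^ n * (\<Prod>i<n. q i) \<le> (\<Prod>i<n. z i)" for n
    proof
      show "1 \<le> (\<Prod>i<n. q i)" using ratio by (intro prod_ge_1) auto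
      have nonneg: "0 \<le> \<rho> * q i" for i
        using ratio[of i] \<rho> by (intro mult_nonneg_nonneg) linarith+
      have "\<rho> ^ n * (\<Prod>i<n. q i) = (\<Prod>i<n. \<rho> * q i)" by (simp add: prod.distrib)
      also have "\<dots> \<le> (\<Prod>i<n. z i)"
        using ratio nonneg by (intro prod_mono) auto
      finally show "\<rho> ^ n * (\<Prod>i<n. q i) \<le> (\<Prod>i<n. z i)" .
    qed
    obtain n where n: "a / b < \<rho> ^ n" using real_arch_pow[OF \<rho>] by blast
    let ?Q = "\<Prod>i<n. q i"
    have "b * \<rho> ^ n * ?Q \<le> b * (\<Prod>i<n. z i)"
      using prods[of n] \<open>0 < b\<close> by (simp add: mult.assoc)
    also have "\<dots> \<le> a * ?Q" by (rule growth)
    finally have "b * \<rho> ^ n \<le> a" using prods[of n] by (simp add: mult_le_cancel_right)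
    then show False using n \<open>0 < b\<close> by (simp add: field_simps)
  qed
qed

section \<open>Coefficients of roots\<close>

text \<open>
  The relation between the coefficients of corresponding positive roots. Equality of the zero
  patterns is included because the signs, not only the sizes, of the three coefficients have
  to agree.
\<close>

definition dominates :: "real \<Rightarrow> real \<Rightarrow> real \<Rightarrow> bool" where
  "dominates a b c \<longleftrightarrow> 0 \<le> a \<and> 0 \<le> b \<and> 0 \<le> c \<and> c\<^sup>2 \<le> a * b \<and> (c = 0 \<longrightarrow> a = 0 \<and> b = 0)"

lemma dominates_self: "0 \<le> a \<Longrightarrow> dominates a a a"
  by (simp add: dominates_def power2_eq_square)

text \<open>The Cauchy-Schwarz inequality for \<open>(\<surd>a, \<surd>a')\<close> and \<open>(\<surd>b, \<surd>b')\<close>.\<close>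

lemma dominates_add:
  assumes "dominates a b c" "dominates a' b' c'"
  shows "dominates (a + a') (b + b') (c + c')"
proof -
  note d = assms[unfolded dominates_def]
  have "(c * c')\<^sup>2 \<le> (a * b) * (a' * b')"
    unfolding power_mult_distrib using d by (intro mult_mono) auto
  also have "\<dots> = (a * b') * (a' * b)" by simp
  also have "\<dots> \<le> ((a * b' + a' * b) / 2)\<^sup>2"
    using sum_squares_ge_zero[of "a * b' - a' * b" 0] by (simp add: power2_eq_square algebra_simps)
  finally have "c * c' \<le> (a * b' + a' * b) / 2"
    by (rule power2_le_imp_le) (use d in auto)
  then have "(c + c')\<^sup>2 \<le> (a + a') * (b + b')"
    using d by (simp add: power2_eq_square algebra_simps)
  then show ?thesis using d unfolding dominates_def by (auto simp: add_nonneg_eq_0_iff)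
qed

lemma dominates_mult:
  assumes "dominates a b c" "dominates a' b' c'"
  shows "dominates (a * a') (b * b') (c * c')"
proof -
  note d = assms[unfolded dominates_def]
  have "(c * c')\<^sup>2 \<le> (a * b) * (a' * b')"
    unfolding power_mult_distrib using d by (intro mult_mono) auto
  then show ?thesis using d unfolding dominates_def by (auto simp: mult_ac)
qed

lemma signed_dominates_sgn:
  assumes "dominates a b c \<or> dominates (- a) (- b) (- c)"
  shows "sgn a = sgn c" "sgn b = sgn c" "c\<^sup>2 \<le> a * b"
proof -
  have pos: "sgn a = sgn c \<and> sgn b = sgn c" if "dominates a b c" for a b c
  proof (cases "c = 0")
    case False
    then have "0 < c" "0 < a * b" using that unfolding dominates_def
      by (auto intro: less_le_trans[of 0 "c\<^sup>2"])
    then show ?thesis using that unfolding dominates_def by (auto simp: zero_less_mult_iff)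
  qed (use that in \<open>auto simp: dominates_def\<close>)
  show "sgn a = sgn c" "sgn b = sgn c"
    using assms pos[of a b c] pos[of "- a" "- b" "- c"] by (auto simp: sgn_minus)
  show "c\<^sup>2 \<le> a * b" using assms by (auto simp: dominates_def)
qed

text \<open>
  An asymmetric form and its symmetrization on one space. Both sides of a Coxeter datum and
  its standard geometric realization live on this space, through \<open>B\<close>, its flip, and \<open>F\<close>, and
  the basis \<open>e\<close> gives all three kinds of roots well-defined coefficients.
\<close>

locale matched_forms =
  B: cartan_form S m B e + F: cartan_form S m F e
  for S :: "'s set" and m :: "'s \<Rightarrow> 's \<Rightarrow> enat"
    and B F :: "'v::real_vector \<Rightarrow> 'v \<Rightarrow> real" and e :: "'s \<Rightarrow> 'v" +
  assumes F_sym: "F x y = F y x"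
    and F_square: "\<lbrakk>s \<in> S; t \<in> S\<rbrakk> \<Longrightarrow> (F (e s) (e t))\<^sup>2 = B (e s) (e t) * B (e t) (e s)"
    and e_inj: "inj_on e S"
    and e_independent: "independent (e ` S)"
    and e_span: "span (e ` S) = UNIV"
begin

sublocale B': cartan_form S m "\<lambda>x y. B y x" e
  by (rule B.cartan_form_flip)

definition coeff :: "'s \<Rightarrow> 'v \<Rightarrow> real" where
  "coeff u x = representation (e ` S) x (e u)"

lemma coeff_simps:
  "coeff u (x + y) = coeff u x + coeff u y" "coeff u (x - y) = coeff u x - coeff u y"
  "coeff u (r *\<^sub>R x) = r * coeff u x"
  by (simp_all add: coeff_def representation_add representation_diff representation_scale
      e_independent e_span)

lemma coeff_basis: "\<lbrakk>s \<in> S; u \<in> S\<rbrakk> \<Longrightarrow> coeff u (e s) = (if u = s then 1 else 0)"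
  using inj_onD[OF e_inj, of s u] by (auto simp: coeff_def representation_basis[OF e_independent])

lemma eq_scaleR_basis_if_coeff_zero:
  assumes "s \<in> S" "\<And>u. \<lbrakk>u \<in> S; u \<noteq> s\<rbrakk> \<Longrightarrow> coeff u x = 0"
  shows "x = coeff s x *\<^sub>R e s"
proof -
  have supp: "{b. representation (e ` S) x b \<noteq> 0} \<subseteq> {e s}"
    using assms(2) representation_ne_zero[of "e ` S" x] unfolding coeff_def by blast
  have "x = (\<Sum>b | representation (e ` S) x b \<noteq> 0. representation (e ` S) x b *\<^sub>R b)"
    using sum_nonzero_representation_eq[OF e_independent, of x] e_span by simp
  also have "\<dots> = (\<Sum>b\<in>{e s}. representation (e ` S) x b *\<^sub>R b)"
    using supp by (intro sum.mono_neutral_left) auto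
  finally show ?thesis by (simp add: coeff_def)
qed

text \<open>
  The same element of the group applied to the same simple root on the three sides. This makes
  the correspondences \<open>\<phi>\<close> and \<open>\<phi>\<^sub>1\<close> between the root systems into projections.
\<close>

definition root_triple :: "'s list \<Rightarrow> 's \<Rightarrow> 'v \<times> 'v \<times> 'v" where
  "root_triple w s =
    (refl_word B e w (e s), refl_word (\<lambda>x y. B y x) e w (e s), refl_word F e w (e s))"

definition root_triples :: "('v \<times> 'v \<times> 'v) set" where
  "root_triples = {root_triple w s | w s. w \<in> lists S \<and> s \<in> S}"

lemma F_product: "\<lbrakk>s \<in> S; t \<in> S\<rbrakk> \<Longrightarrow> F (e s) (e t) * F (e t) (e s) = B (e s) (e t) * B (e t) (e s)"
  using F_square[of s t] F_sym[of "e t" "e s"] by (simp add: power2_eq_square)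

text \<open>
  This sharpens the positivity of \<open>w e\<^sub>s\<close> for ascents \<open>s\<close> of \<open>w\<close>. A rank two computation
  expresses the root by \<open>v e\<^sub>s\<close> and \<open>v e\<^sub>t\<close> with \<open>v\<close> shorter than \<open>w\<close>. The scalars are the
  same nonnegative numbers on the three sides, except for the factors \<open>- B (e s) (e t)\<close>, \<open>- B
  (e t) (e s)\<close> and \<open>- F (e s) (e t)\<close>. The last of these is the geometric mean of the first
  two, so both terms are dominated by induction, and so is their sum.
\<close>

lemma coeff_dominates_of_ascent:
  assumes "w \<in> lists S" "s \<in> S" "\<not> coxeter_length S m (w @ [s]) < coxeter_length S m w" "u \<in> S"
  shows "dominates (coeff u (refl_word B e w (e s))) (coeff u (refl_word (\<lambda>x y. B y x) e w (e s)))
    (coeff u (refl_word F e w (e s)))"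
proof -
  have "\<forall>u\<in>S. dominates (coeff u (refl_word B e w (e s)))
    (coeff u (refl_word (\<lambda>x y. B y x) e w (e s))) (coeff u (refl_word F e w (e s)))"
    using assms(1-3)
  proof (induction rule: B.ascent_induct)
    case (cong w w' s)
    then show ?case
      by (simp add: B.refl_word_cong[OF cong(1)] B'.refl_word_cong[OF cong(1)] F.refl_word_cong[OF cong(1)])
  next
    case (one s)
    then show ?case by (auto simp: coeff_basis intro: dominates_self)
  next
    case (dihedral v s t k)
    let ?p = "B (e s) (e t) * B (e t) (e s)"
    let ?a = "dihedral_coeff ?p (if even k then Suc k else k)"
    let ?b = "dihedral_coeff ?p (if even k then k else Suc k)"
    have nonneg: "0 \<le> dihedral_coeff ?p j" if "j = k \<or> j = Suc k" for j
    proof (cases "m s t")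
      case (enat n)
      then have "2 \<le> n" "j \<le> n"
        using B.m_off_diag[OF dihedral(2-4)] dihedral(5) that by (auto simp: numeral_eq_enat)
      then show ?thesis
        using B.G_finite[OF dihedral(2,3) enat] dihedral_coeff_nonneg_finite by simp
    qed (use B.G_infinite[OF dihedral(2,3)] dihedral_coeff_nonneg_infinite in simp)
    have a: "dominates ?a ?a ?a" and b: "dominates ?b ?b ?b"
      by (intro dominates_self nonneg, simp)+
    have gh: "dominates (- B (e s) (e t)) (- B (e t) (e s)) (- F (e s) (e t))"
    proof -
      have zero: "B (e s) (e t) = 0 \<longleftrightarrow> B (e t) (e s) = 0"
        using B.G_zero dihedral(2,3) by blast
      have square: "(F (e s) (e t))\<^sup>2 = B (e s) (e t) * B (e t) (e s)"
        using F_square dihedral(2,3) .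
      then have "B (e s) (e t) = 0 \<and> B (e t) (e s) = 0" if "F (e s) (e t) = 0"
        using that zero by auto
      then show ?thesis
        using square B.G_off_diag dihedral(2-4) F.G_off_diag by (auto simp: dominates_def)
    qed
    have expand:
      "refl_word B e (v @ alt_word s t k) (e s)
        = ?a *\<^sub>R refl_word B e v (e s) + ((- B (e s) (e t)) * ?b) *\<^sub>R refl_word B e v (e t)"
      "refl_word (\<lambda>x y. B y x) e (v @ alt_word s t k) (e s)
        = ?a *\<^sub>R refl_word (\<lambda>x y. B y x) e v (e s)
          + ((- B (e t) (e s)) * ?b) *\<^sub>R refl_word (\<lambda>x y. B y x) e v (e t)"
      "refl_word F e (v @ alt_word s t k) (e s)
        = ?a *\<^sub>R refl_word F e v (e s) + ((- F (e s) (e t)) * ?b) *\<^sub>R refl_word F e v (e t)"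
      unfolding refl_word_append
        B.refl_word_alt_word[OF dihedral(2,3)] B'.refl_word_alt_word[OF dihedral(2,3)]
        F.refl_word_alt_word[OF dihedral(2,3)] F_product[OF dihedral(2,3)]
        linear_add[OF B.refl_word_linear] linear_scale[OF B.refl_word_linear]
        linear_add[OF B'.refl_word_linear] linear_scale[OF B'.refl_word_linear]
        linear_add[OF F.refl_word_linear] linear_scale[OF F.refl_word_linear]
      by (simp_all add: mult.commute[of "B (e t) (e s)"])
    show ?case
      unfolding expand coeff_simps using dihedral(6,7)
      by (intro ballI dominates_add dominates_mult a b gh) auto
  qed
  then show ?thesis using assms(4) by blast
qed

lemma refl_word_descent:
  assumes "s \<in> S"
  shows "refl_word B e (w @ [s]) (e s) = - refl_word B e w (e s)"
    "refl_word (\<lambda>x y. B y x) e (w @ [s]) (e s) = - refl_word (\<lambda>x y. B y x) e w (e s)"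
    "refl_word F e (w @ [s]) (e s) = - refl_word F e w (e s)"
  using assms
  by (simp_all add: refl_word_append B.refl_word_singleton B'.refl_word_singleton
      F.refl_word_singleton B.G_diag F.G_diag scaleR_2 linear_neg[OF B.refl_word_linear]
      linear_neg[OF B'.refl_word_linear] linear_neg[OF F.refl_word_linear])

lemma root_triple_coeff_dominates:
  assumes "(x1, x2, x3) \<in> root_triples" "u \<in> S"
  shows "dominates (coeff u x1) (coeff u x2) (coeff u x3)
    \<or> dominates (- coeff u x1) (- coeff u x2) (- coeff u x3)"
proof -
  obtain w s where w: "w \<in> lists S" "s \<in> S"
    and x: "x1 = refl_word B e w (e s)" "x2 = refl_word (\<lambda>x y. B y x) e w (e s)"
      "x3 = refl_word F e w (e s)"
    using assms(1) by (auto simp: root_triples_def root_triple_def)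
  show ?thesis
  proof (cases "coxeter_length S m (w @ [s]) < coxeter_length S m w")
    case False
    then show ?thesis using coeff_dominates_of_ascent[OF w _ assms(2)] x by simp
  next
    case True
    have "coxeter_eq S m ((w @ [s]) @ [s]) w"
      using B.gen_gen_cancel[of s w "[]"] w by simp
    then have "\<not> coxeter_length S m ((w @ [s]) @ [s]) < coxeter_length S m (w @ [s])"
      using True by (simp only: coxeter_length_cong less_imp_not_less not_False_eq_True)
    then have "dominates (coeff u (- x1)) (coeff u (- x2)) (coeff u (- x3))"
      using coeff_dominates_of_ascent[of "w @ [s]" s u] w assms(2) refl_word_descent[OF w(2)] x by simp
    then show ?thesis
      using coeff_simps(3)[of u "-1"] by simp
  qed
qed

text \<open>
  The simple root \<open>e\<^sub>s\<close>, reflected in the given root on each side. The three pairings of the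
  root with \<open>e\<^sub>s\<close> thereby become coefficients of a new root.
\<close>

lemma root_triple_reflect_basis:
  assumes "(x1, x2, x3) \<in> root_triples" "s \<in> S"
  shows "(e s - (2 * B (e s) x2) *\<^sub>R x1, e s - (2 * B x1 (e s)) *\<^sub>R x2, e s - (2 * F x3 (e s)) *\<^sub>R x3)
    \<in> root_triples"
proof -
  obtain w t where w: "w \<in> lists S" "t \<in> S"
    and x: "x1 = refl_word B e w (e t)" "x2 = refl_word (\<lambda>x y. B y x) e w (e t)"
      "x3 = refl_word F e w (e t)"
    using assms(1) by (auto simp: root_triples_def root_triple_def)
  have Fflip: "(\<lambda>x y. F y x) = F" using F_sym by (intro ext)
  have "root_triple (w @ [t] @ rev w) s
    = (e s - (2 * B (e s) x2) *\<^sub>R x1, e s - (2 * B x1 (e s)) *\<^sub>R x2, e s - (2 * F x3 (e s)) *\<^sub>R x3)"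
    using B.refl_word_conjugate[OF w, of "e s"] B'.refl_word_conjugate[OF w, of "e s"]
      F.refl_word_conjugate[OF w, of "e s"] F_sym[of "e s" x3]
    unfolding root_triple_def Fflip x by simp
  moreover have "root_triple (w @ [t] @ rev w) s \<in> root_triples"
  proof -
    have "w @ [t] @ rev w \<in> lists S" using w by auto
    then show ?thesis using assms(2) unfolding root_triples_def by blast
  qed
  ultimately show ?thesis by simp
qed

text \<open>
  Since zero patterns agree on the three sides, being a multiple of \<open>e\<^sub>s\<close> does not depend on
  the side.
\<close>

lemma root_triple_cases:
  assumes x: "(x1, x2, x3) \<in> root_triples" and s: "s \<in> S"
  obtains (coeff) u where "u \<in> S" "u \<noteq> s" "coeff u x3 \<noteq> 0"
  | (multiple) c1 c2 c3 where "x1 = c1 *\<^sub>R e s" "x2 = c2 *\<^sub>R e s" "x3 = c3 *\<^sub>R e s"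
proof (cases "\<exists>u\<in>S. u \<noteq> s \<and> coeff u x3 \<noteq> 0")
  case False
  then have "coeff u x1 = 0 \<and> coeff u x2 = 0 \<and> coeff u x3 = 0" if "u \<in> S" "u \<noteq> s" for u
    using signed_dominates_sgn(1,2)[OF root_triple_coeff_dominates[OF x that(1)]] that
    by (auto simp: sgn_eq_0_iff)
  then show ?thesis using eq_scaleR_basis_if_coeff_zero[OF s] multiple by blast
qed (use coeff in blast)

text \<open>
  At \<open>u \<noteq> s\<close> the reflected triple has the coefficients of the given one multiplied by minus
  twice the pairings. Both triples have matching signs at \<open>u\<close>, hence so do the pairings,
  provided that the coefficient at some such \<open>u\<close> is nonzero. Otherwise the roots are multiples
  of \<open>e\<^sub>s\<close>, and the pairings are the multipliers.
\<close>

lemma root_triple_pairing_sgn: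
  assumes x: "(x1, x2, x3) \<in> root_triples" and s: "s \<in> S"
  shows "sgn (B x1 (e s)) = sgn (F x3 (e s))" "sgn (B (e s) x2) = sgn (F x3 (e s))"
proof -
  note dom = signed_dominates_sgn[OF root_triple_coeff_dominates]
  have "sgn (B x1 (e s)) = sgn (F x3 (e s)) \<and> sgn (B (e s) x2) = sgn (F x3 (e s))"
    using x s
  proof (cases rule: root_triple_cases)
    case (coeff u)
    then show ?thesis
      using dom(1,2)[OF root_triple_reflect_basis[OF x s] coeff(1)] dom(1,2)[OF x coeff(1)] s
      by (simp add: coeff_simps coeff_basis sgn_mult sgn_eq_0_iff)
  next
    case (multiple c1 c2 c3)
    then show ?thesis
      using dom(1,2)[OF x s] s
      by (simp add: coeff_simps coeff_basis B.G_simps F.G_simps B.G_diag F.G_diag)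
  qed
  then show "sgn (B x1 (e s)) = sgn (F x3 (e s))" "sgn (B (e s) x2) = sgn (F x3 (e s))" by auto
qed

section \<open>The pairing of a root with a simple root\<close>

text \<open>
  Replace the root \<open>x\<close> by the reflection of \<open>e\<^sub>s\<close> in \<open>x\<close>, and iterate. The product \<open>q\<close> of the
  two pairings and the square \<open>z\<close> of the third one both evolve by \<open>y \<mapsto> (1 - 2 y)\<^sup>2\<close>, and the
  pairings themselves become \<open>1 - 2 q\<close> and \<open>1 - 2 z\<close>, so that the two orbits have the same
  itinerary. The coefficients at some \<open>u \<noteq> s\<close> are multiplied in each step by the pairings, up
  to the constant \<open>-2\<close>, so that the bound on coefficients compares the products along the two
  orbits.
\<close>

lemma root_triple_pairing_bound:
  assumes x: "(x1, x2, x3) \<in> root_triples" and s: "s \<in> S"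
  shows "(F x3 (e s))\<^sup>2 \<le> B x1 (e s) * B (e s) x2"
  using x s
proof (cases rule: root_triple_cases)
  case (multiple c1 c2 c3)
  then show ?thesis
    using signed_dominates_sgn(3)[OF root_triple_coeff_dominates[OF x s]] s
    by (simp add: coeff_simps coeff_basis B.G_simps F.G_simps B.G_diag F.G_diag)
next
  case (coeff u)
  define xs where "xs n = ((\<lambda>(a, b, c). (e s - (2 * B (e s) b) *\<^sub>R a, e s - (2 * B a (e s)) *\<^sub>R b,
    e s - (2 * F c (e s)) *\<^sub>R c)) ^^ n) (x1, x2, x3)" for n
  define a b c where "a n = fst (xs n)" "b n = fst (snd (xs n))" "c n = snd (snd (xs n))" for n
  have zero: "a 0 = x1" "b 0 = x2" "c 0 = x3" by (simp_all add: a_b_c_def xs_def)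
  have step: "a (Suc n) = e s - (2 * B (e s) (b n)) *\<^sub>R a n"
    "b (Suc n) = e s - (2 * B (a n) (e s)) *\<^sub>R b n"
    "c (Suc n) = e s - (2 * F (c n) (e s)) *\<^sub>R c n" for n
    by (simp_all add: a_b_c_def xs_def split_beta)
  have root: "(a n, b n, c n) \<in> root_triples" for n
  proof (induction n)
    case (Suc n)
    then show ?case unfolding step by (rule root_triple_reflect_basis[OF _ s])
  qed (simp add: zero x)
  define q where "q n = B (a n) (e s) * B (e s) (b n)" for n
  define z where "z n = (F (c n) (e s))\<^sup>2" for n
  have pair_Suc: "B (a (Suc n)) (e s) = 1 - 2 * q n" "B (e s) (b (Suc n)) = 1 - 2 * q n"
    "F (c (Suc n)) (e s) = 1 - 2 * z n" for n
    using s by (simp_all add: step q_def z_def B.G_simps F.G_simps B.G_diag F.G_diag power2_eq_square)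
  have coeff_prods: "coeff u (a n) * coeff u (b n) = coeff u x1 * coeff u x2 * 4 ^ n * (\<Prod>i<n. q i)"
    "(coeff u (c n))\<^sup>2 = (coeff u x3)\<^sup>2 * 4 ^ n * (\<Prod>i<n. z i)" for n
  proof (induction n)
    case (Suc n)
    have "coeff u (a (Suc n)) * coeff u (b (Suc n)) = 4 * q n * (coeff u (a n) * coeff u (b n))"
      "(coeff u (c (Suc n)))\<^sup>2 = 4 * z n * (coeff u (c n))\<^sup>2"
      using coeff(1,2) s
      by (simp_all add: step coeff_simps coeff_basis q_def z_def power_mult_distrib)
    then show "coeff u (a (Suc n)) * coeff u (b (Suc n))
        = coeff u x1 * coeff u x2 * 4 ^ Suc n * (\<Prod>i<Suc n. q i)"
      "(coeff u (c (Suc n)))\<^sup>2 = (coeff u x3)\<^sup>2 * 4 ^ Suc n * (\<Prod>i<Suc n. z i)"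
      by (simp_all add: Suc.IH)
  qed (simp_all add: zero)
  have "z 0 \<le> q 0"
  proof (rule logistic_le_of_itinerary_and_growth)
    show "q (Suc n) = (1 - 2 * q n)\<^sup>2" "z (Suc n) = (1 - 2 * z n)\<^sup>2" for n
      using pair_Suc[of n] by (simp_all add: q_def[of "Suc n"] z_def[of "Suc n"] power2_eq_square)
    show "0 \<le> q 0"
      using root_triple_pairing_sgn[OF x s] unfolding q_def zero
      by (simp add: sgn_if zero_le_mult_iff split: if_splits)
    show "0 \<le> z 0" by (simp add: z_def)
    show "sgn (1 - 2 * q n) = sgn (1 - 2 * z n)" for n
      using root_triple_pairing_sgn(1)[OF root[of "Suc n"] s] unfolding pair_Suc .
    show "0 < (coeff u x3)\<^sup>2" using coeff(3) by simp
    show "(coeff u x3)\<^sup>2 * (\<Prod>i<n. z i) \<le> coeff u x1 * coeff u x2 * (\<Prod>i<n. q i)" for n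
    proof -
      have "4 ^ n * ((coeff u x3)\<^sup>2 * (\<Prod>i<n. z i)) \<le> 4 ^ n * (coeff u x1 * coeff u x2 * (\<Prod>i<n. q i))"
        using signed_dominates_sgn(3)[OF root_triple_coeff_dominates[OF root[of n] coeff(1)]]
        unfolding coeff_prods by (simp add: mult_ac)
      then show ?thesis by (simp only: mult_le_cancel_left_pos zero_less_power zero_less_numeral)
    qed
  qed
  then show ?thesis by (simp add: q_def z_def zero)
qed

text \<open>
  Invariance moves \<open>w\<close> to the other argument, which leaves one root and one simple root.
\<close>

lemma refl_word_pairing_bound:
  assumes "v \<in> lists S" "w \<in> lists S" "s \<in> S" "t \<in> S"
  shows "(F (refl_word F e v (e s)) (refl_word F e w (e t)))\<^sup>2
    \<le> B (refl_word B e v (e s)) (refl_word (\<lambda>x y. B y x) e w (e t))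
      * B (refl_word B e w (e t)) (refl_word (\<lambda>x y. B y x) e v (e s))"
proof -
  have Fflip: "(\<lambda>x y. F y x) = F" using F_sym by (intro ext)
  have "rev w @ v \<in> lists S" using assms by auto
  then have "root_triple (rev w @ v) s \<in> root_triples"
    using assms(3) unfolding root_triples_def by blast
  note bound = root_triple_pairing_bound[OF this[unfolded root_triple_def] assms(4)]
  show ?thesis
    unfolding B.refl_word_move[OF assms(2), where v = v and x = "e s" and y = "e t"]
      B'.refl_word_move[OF assms(2), where v = v and x = "e s" and y = "e t"]
      F.refl_word_move[OF assms(2), where v = v and x = "e s" and y = "e t", unfolded Fflip]
    by (rule bound)
qed

end

section \<open>From group actions to words on a common space\<close>

lemma reflection_action_coxeter_class:
  assumes act: "reflection_action S m f e act" and "w \<in> lists S"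
  shows "act (coxeter_class S m w) x = foldr (\<lambda>s x. x - (2 * f s x) *\<^sub>R e s) w x"
  using assms(2)
proof (induction w)
  case Nil
  interpret group_action "coxeter_group S m" UNIV act
    using act by (simp add: reflection_action_def)
  show ?case using id_eq_one[symmetric] by (simp add: coxeter_group_def)
next
  case (Cons s w)
  interpret group_action "coxeter_group S m" UNIV act
    using act by (simp add: reflection_action_def)
  have w: "[s] \<in> lists S" "w \<in> lists S" using Cons by auto
  then have "coxeter_class S m [s] \<in> carrier (coxeter_group S m)"
    "coxeter_class S m w \<in> carrier (coxeter_group S m)"
    by (simp_all only: coxeter_group_def partial_object.simps imageI)
  then have "act (coxeter_class S m (s # w)) x = act (coxeter_gen S m s) (act (coxeter_class S m w) x)"
    using composition_rule[of x "coxeter_class S m [s]" "coxeter_class S m w"]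
      coxeter_mult_class[OF w, of m] by (simp add: coxeter_gen_def)
  then show ?case using act Cons by (simp add: reflection_action_def)
qed

lemma root_set_cases:
  assumes "x \<in> root_set S m act e"
  obtains w s where "w \<in> lists S" "s \<in> S" "x = act (coxeter_class S m w) (e s)"
  using assms by (auto simp: root_set_def orbit_def coxeter_group_def)

lemma (in standard_realization) lift_exists:
  fixes f :: "'s \<Rightarrow> 'x::real_vector"
  obtains p where "linear p" "\<And>s. s \<in> S \<Longrightarrow> p (\<gamma> s) = f s"
proof -
  obtain p where "linear p" "\<forall>x\<in>\<gamma> ` S. p x = f (inv_into S \<gamma> x)"
    using linear_independent_extend[OF \<gamma>_independent, of "\<lambda>x. f (inv_into S \<gamma> x)"] by blast
  then show ?thesis using that[of p] \<gamma>_inj by simp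
qed

theorem proposition4p12:
  fixes S :: "'s set" and m :: "'s \<Rightarrow> 's \<Rightarrow> enat"
    and pairing :: "'v1::real_vector \<Rightarrow> 'v2::real_vector \<Rightarrow> real"
    and \<alpha> :: "'s \<Rightarrow> 'v1" and \<beta> :: "'s \<Rightarrow> 'v2"
    and form :: "'v::real_vector \<Rightarrow> 'v \<Rightarrow> real" and \<gamma> :: "'s \<Rightarrow> 'v"
    and act1 :: "'s list set \<Rightarrow> 'v1 \<Rightarrow> 'v1"
    and act2 :: "'s list set \<Rightarrow> 'v2 \<Rightarrow> 'v2"
    and act :: "'s list set \<Rightarrow> 'v \<Rightarrow> 'v"
    and \<phi> :: "'v1 \<Rightarrow> 'v2" and \<phi>1 :: "'v1 \<Rightarrow> 'v"
    and \<alpha>1 \<alpha>2 :: 'v1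
  assumes "coxeter_datum S m pairing \<alpha> \<beta>"
    and "standard_realization S m pairing \<alpha> \<beta> form \<gamma>"
    and "reflection_action S m (\<lambda>s x. pairing x (\<beta> s)) \<alpha> act1"
    and "reflection_action S m (\<lambda>s y. pairing (\<alpha> s) y) \<beta> act2"
    and "reflection_action S m (\<lambda>s v. form v (\<gamma> s)) \<gamma> act"
    and "bij_betw \<phi> (root_set S m act1 \<alpha>) (root_set S m act2 \<beta>)"
    and "equivariant_on S m act1 act2 (root_set S m act1 \<alpha>) \<phi>"
    and "\<And>s. s \<in> S \<Longrightarrow> \<phi> (\<alpha> s) = \<beta> s"
    and "\<phi>1 ` root_set S m act1 \<alpha> \<subseteq> root_set S m act \<gamma>"
    and "equivariant_on S m act1 act (root_set S m act1 \<alpha>) \<phi>1"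
    and "\<And>s. s \<in> S \<Longrightarrow> \<phi>1 (\<alpha> s) = \<gamma> s"
    and "\<alpha>1 \<in> root_set S m act1 \<alpha>" and "\<alpha>2 \<in> root_set S m act1 \<alpha>"
  shows "pairing \<alpha>1 (\<phi> \<alpha>2) * pairing \<alpha>2 (\<phi> \<alpha>1) \<ge> (form (\<phi>1 \<alpha>1) (\<phi>1 \<alpha>2))\<^sup>2"
proof -
  interpret standard_realization S m pairing \<alpha> \<beta> form \<gamma> by (rule assms(2))
  \<comment> \<open>Neither family of simple roots has to be independent, so coefficients of roots are taken after
    lifting both sides to the space with basis \<open>\<gamma>\<close>.\<close>
  obtain p1 where p1: "linear p1" "\<And>s. s \<in> S \<Longrightarrow> p1 (\<gamma> s) = \<alpha> s"
    using lift_exists[of \<alpha>] by blast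
  obtain p2 where p2: "linear p2" "\<And>s. s \<in> S \<Longrightarrow> p2 (\<gamma> s) = \<beta> s"
    using lift_exists[of \<beta>] by blast
  define B where "B x y = pairing (p1 x) (p2 y)" for x y
  have B_basis: "B (\<gamma> s) (\<gamma> t) = pairing (\<alpha> s) (\<beta> t)" if "s \<in> S" "t \<in> S" for s t
    using that p1 p2 by (simp add: B_def)
  interpret matched_forms S m B form \<gamma>
  proof (unfold_locales)
    show "bilinear B"
      unfolding bilinear_def B_def
      by (intro conjI allI linearI)
        (simp_all add: linear_add[OF p1(1)] linear_add[OF p2(1)] linear_scale[OF p1(1)]
          linear_scale[OF p2(1)] bilinear_ladd[OF pairing_bilinear] bilinear_radd[OF pairing_bilinear]
          bilinear_lmul[OF pairing_bilinear] bilinear_rmul[OF pairing_bilinear])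
    show "bilinear form" by (rule form_bilinear)
    show "1 \<le> B (\<gamma> s) (\<gamma> t) * B (\<gamma> t) (\<gamma> s)" if "s \<in> S" "t \<in> S" "m s t = \<infinity>" for s t
      using C3_infinite[OF that] that by (auto simp: B_basis one_le_power)
    have product: "form (\<gamma> s) (\<gamma> t) * form (\<gamma> t) (\<gamma> s) = pairing (\<alpha> s) (\<beta> t) * pairing (\<alpha> t) (\<beta> s)"
      if "s \<in> S" "t \<in> S" for s t
      using form_square[OF that] form_sym[of "\<gamma> t" "\<gamma> s"] by (simp add: power2_eq_square)
    show "1 \<le> form (\<gamma> s) (\<gamma> t) * form (\<gamma> t) (\<gamma> s)" if "s \<in> S" "t \<in> S" "m s t = \<infinity>" for s t
      using C3_infinite[OF that] product[OF that(1,2)] by (auto simp: one_le_power)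
    show "form (\<gamma> s) (\<gamma> t) * form (\<gamma> t) (\<gamma> s) = (cos (pi / real n))\<^sup>2"
      if "s \<in> S" "t \<in> S" "m s t = enat n" for s t n
      using C3_finite[OF that] product[OF that(1,2)] by simp
    show "form (\<gamma> t) (\<gamma> s) = 0" if "s \<in> S" "t \<in> S" "form (\<gamma> s) (\<gamma> t) = 0" for s t
      using form_sym[of "\<gamma> t" "\<gamma> s"] that by simp
    show "form x y = form y x" for x y by (rule form_sym)
  qed (use C1 C2 C3_finite C4 form_diag form_off_diag form_square \<gamma>_inj \<gamma>_independent \<gamma>_span
      in \<open>simp_all add: B_basis\<close>)
  have root1: "act1 (coxeter_class S m w) (\<alpha> s) = p1 (refl_word B \<gamma> w (\<gamma> s))"
    and root2: "act2 (coxeter_class S m w) (\<beta> s) = p2 (refl_word (\<lambda>x y. B y x) \<gamma> w (\<gamma> s))"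
    and root: "act (coxeter_class S m w) (\<gamma> s) = refl_word form \<gamma> w (\<gamma> s)"
    if "w \<in> lists S" "s \<in> S" for w s
  proof -
    have "foldr (\<lambda>s x. x - (2 * pairing x (\<beta> s)) *\<^sub>R \<alpha> s) w (\<alpha> s) = p1 (refl_word B \<gamma> w (\<gamma> s))"
      using that(1)
      by (induction w)
        (simp_all add: that p1 p2 B_def refl_word_Cons linear_diff[OF p1(1)] linear_scale[OF p1(1)])
    then show "act1 (coxeter_class S m w) (\<alpha> s) = p1 (refl_word B \<gamma> w (\<gamma> s))"
      using reflection_action_coxeter_class[OF assms(3) that(1)] by simp
    have "foldr (\<lambda>s y. y - (2 * pairing (\<alpha> s) y) *\<^sub>R \<beta> s) w (\<beta> s) = p2 (refl_word (\<lambda>x y. B y x) \<gamma> w (\<gamma> s))"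
      using that(1)
      by (induction w)
        (simp_all add: that p1 p2 B_def refl_word_Cons linear_diff[OF p2(1)] linear_scale[OF p2(1)])
    then show "act2 (coxeter_class S m w) (\<beta> s) = p2 (refl_word (\<lambda>x y. B y x) \<gamma> w (\<gamma> s))"
      using reflection_action_coxeter_class[OF assms(4) that(1)] by simp
    show "act (coxeter_class S m w) (\<gamma> s) = refl_word form \<gamma> w (\<gamma> s)"
      using reflection_action_coxeter_class[OF assms(5) that(1)] by (simp add: refl_word_def)
  qed
  have images: "\<phi> (act1 (coxeter_class S m w) (\<alpha> s)) = act2 (coxeter_class S m w) (\<beta> s)"
    "\<phi>1 (act1 (coxeter_class S m w) (\<alpha> s)) = act (coxeter_class S m w) (\<gamma> s)"
    if "w \<in> lists S" "s \<in> S" for w s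
  proof -
    have w: "coxeter_class S m w \<in> carrier (coxeter_group S m)"
      using that by (simp add: coxeter_group_def)
    have "coxeter_class S m [] \<in> carrier (coxeter_group S m)"
      by (simp add: coxeter_group_def)
    moreover have "act1 (coxeter_class S m []) (\<alpha> s) = \<alpha> s"
      using reflection_action_coxeter_class[OF assms(3), of "[]"] by simp
    ultimately have "\<alpha> s \<in> root_set S m act1 \<alpha>"
      using that(2) unfolding root_set_def orbit_def by force
    then show "\<phi> (act1 (coxeter_class S m w) (\<alpha> s)) = act2 (coxeter_class S m w) (\<beta> s)"
      "\<phi>1 (act1 (coxeter_class S m w) (\<alpha> s)) = act (coxeter_class S m w) (\<gamma> s)"
      using assms(7,8,10,11) that(2) w unfolding equivariant_on_def by auto
  qed
  obtain v s where v: "v \<in> lists S" "s \<in> S" "\<alpha>1 = act1 (coxeter_class S m v) (\<alpha> s)"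
    using assms(12) by (rule root_set_cases)
  obtain w t where w: "w \<in> lists S" "t \<in> S" "\<alpha>2 = act1 (coxeter_class S m w) (\<alpha> t)"
    using assms(13) by (rule root_set_cases)
  note coords = root1[OF v(1,2)] root1[OF w(1,2)] root2[OF v(1,2)] root2[OF w(1,2)]
    root[OF v(1,2)] root[OF w(1,2)]
  have "\<phi> \<alpha>1 = p2 (refl_word (\<lambda>x y. B y x) \<gamma> v (\<gamma> s))"
    "\<phi> \<alpha>2 = p2 (refl_word (\<lambda>x y. B y x) \<gamma> w (\<gamma> t))"
    "\<phi>1 \<alpha>1 = refl_word form \<gamma> v (\<gamma> s)" "\<phi>1 \<alpha>2 = refl_word form \<gamma> w (\<gamma> t)"
    unfolding v(3) w(3) images[OF v(1,2)] images[OF w(1,2)] by (rule coords)+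
  moreover have "\<alpha>1 = p1 (refl_word B \<gamma> v (\<gamma> s))" "\<alpha>2 = p1 (refl_word B \<gamma> w (\<gamma> t))"
    unfolding v(3) w(3) by (rule coords)+
  ultimately show ?thesis
    using refl_word_pairing_bound[OF v(1) w(1) v(2) w(2)] by (simp only: B_def)
qed

end
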